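(* Let $q$ be a power of $2$ and let $N=q+1$. Let $A=\mathbb F_q[C]/(\Phi_{q-1}(C))$, let $\overline{\Lambda}_N\in A[B^2]$ be the image of the Lucas atom $\Lambda_N(B,C)\in\mathbb F_q[B^2,C]$ in $A[B]=\mathbb F_q[B,C]/(\Phi_{q-1}(C))$, and let $P_q(B,C)\in\mathbb F_q[B,C]$ be a preimage of $\operatorname{Fr}^{-1}(\overline{\Lambda}_N)\in A[B]$ under the canonical projection $\mathbb F_q[B,C]\to A[B]$. Then for every primitive element $c$ of $\mathbb F_q$, the polynomial $P_q(B,c)\in\mathbb F_q[B]$ is monic and square-free, and its roots are exactly the elements $b\in\mathbb F_q$ for which $X^2+bX+c$ is primitive over $\mathbb F_q$. In particular, $P_q(B,C)$ is an optimal determining polynomial for primitive quadratic polynomials over $\mathbb F_q$.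
   Context: A primitive element of $\mathbb F_q$ is a generator of $\mathbb F_q^*$. A monic polynomial of degree $k\ge1$ over $\mathbb F_q$ is primitive if it is the minimal polynomial over $\mathbb F_q$ of a generator of $\mathbb F_{q^k}^*$. Lucas atoms: let $B,C$ be algebraically independent indeterminates over $\mathbb F_q$, and $\alpha,\beta$ the two roots of $T^2+BT+C$ in an algebraic closure of $\mathbb F_q(B,C)$. Let $\Phi_n(X)\in\mathbb F_q[X]$ be the $n$-th cyclotomic polynomial (the image of the integral one), $\varphi$ Euler's totient function, and $\Phi_n^{\mathrm{hom}}(\alpha,\beta)=\beta^{\varphi(n)}\Phi_n(\alpha/\beta)$. For $n\ge2$ the Lucas atom $\Lambda_n(B,C)\in\mathbb F_q[B,C]$ is the unique polynomial with $\Lambda_n(B,C)=\Phi_n^{\mathrm{hom}}(\alpha,\beta)$. For $n>1$ odd and $q$ even, $\Lambda_n(B,C)\in\mathbb F_q[B^2,C]$. Inverse-Frobenius operator ($q$ even): on $A$ one has $a^q=a$, so $a\mapsto a^2$ is an automorphism of $A$ with inverse $a\mapsto a^{q/2}$. Define $\operatorname{Fr}^{-1}:A[B^2]\to A[B]$ by $\operatorname{Fr}^{-1}\big(\sum_i a_iB^{2i}\big)=\sum_i a_i^{q/2}B^i$ ($a_i\in A$). Explicitly, if $\Lambda_N(B,C)=\sum_{i,j}a_{ij}B^{2i}C^j$ with $a_{ij}\in\mathbb F_q$, one may choose $P_q(B,C)=\sum_{i,j}a_{ij}^{q/2}B^iC^{jq/2}$. A polynomial $P(B,C)\in\mathbb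 F_q[B,C]$ is an optimal determining polynomial for primitive quadratic polynomials over $\mathbb F_q$ if for every primitive element $c$ of $\mathbb F_q$ the polynomial $P(B,c)$ is monic and square-free and its roots are exactly the $b\in\mathbb F_q$ for which $X^2+bX+c$ is primitive, i.e. $P(B,c)=\prod_b(B-b)$ over all such $b$. *)

theory Defs
  imports
    "HOL-Algebra.Algebraic_Closure_Type"
    "HOL-Algebra.QuotRing"
    "HOL-Algebra.UnivPoly"
    "HOL-Number_Theory.Totient"
    "HOL-Computational_Algebra.Computational_Algebra"
    "HOL-Library.FuncSet"
    "HOL-Library.Cardinality"
begin

section \<open>Primitive elements and primitive polynomials\<close>

definition generates_nonzero :: "'b::field set \<Rightarrow> 'b \<Rightarrow> bool" where
  "generates_nonzero S g \<longleftrightarrow> range (\<lambda>i::int. g powi i) = S - {0}"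

definition primitive_element :: "'a::finite_field \<Rightarrow> bool" where
  "primitive_element c \<longleftrightarrow> generates_nonzero UNIV c"

text \<open>The field with \<open>q ^ k\<close> elements, where \<open>q = CARD('a)\<close>, as the unique subfield of that
  cardinality of the algebraic closure of \<open>'a\<close>.\<close>

definition field_ext :: "nat \<Rightarrow> 'a::finite_field alg_closure set" where
  "field_ext k = {x. x ^ (CARD('a) ^ k) = x}"

definition is_minimal_poly :: "'a::field poly \<Rightarrow> 'a alg_closure \<Rightarrow> bool" where
  "is_minimal_poly f x \<longleftrightarrow>
     Polynomial.lead_coeff f = 1 \<and> poly (map_poly to_ac f) x = 0 \<and>
     (\<forall>g. g \<noteq> 0 \<longrightarrow> poly (map_poly to_ac g) x = 0 \<longrightarrow> Polynomial.degree f \<le> Polynomial.degree g)"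

definition primitive_polynomial :: "'a::finite_field poly \<Rightarrow> bool" where
  "primitive_polynomial f \<longleftrightarrow>
     Polynomial.degree f \<ge> 1 \<and> Polynomial.lead_coeff f = 1 \<and>
     (\<exists>g. generates_nonzero (field_ext (Polynomial.degree f)) g \<and> is_minimal_poly f g)"


section \<open>Cyclotomic polynomials and Lucas atoms\<close>

definition cyclotomic_complex :: "nat \<Rightarrow> complex poly" where
  "cyclotomic_complex n = (\<Prod>z | z ^ n = 1 \<and> (\<forall>k\<in>{1..<n}. z ^ k \<noteq> 1). [:-z, 1:])"

definition cyclotomic_int :: "nat \<Rightarrow> int poly" where
  "cyclotomic_int n = (THE p. map_poly of_int p = cyclotomic_complex n)"

definition cyclotomic :: "nat \<Rightarrow> 'a::comm_ring_1 poly" where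
  "cyclotomic n = map_poly of_int (cyclotomic_int n)"

definition cyclotomic_hom :: "nat \<Rightarrow> 'b::field \<Rightarrow> 'b \<Rightarrow> 'b" where
  "cyclotomic_hom n a b = b ^ totient n * poly (cyclotomic n) (a / b)"

text \<open>The ring \<open>F[B,C]\<close> is represented as \<open>F[C][B]\<close>, i.e. as \<open>'a poly poly\<close> whose outer
  variable is \<open>B\<close> and whose inner variable is \<open>C\<close>.\<close>

definition var_B :: "'a::field poly poly" where
  "var_B = [:0, 1:]"

definition var_C :: "'a::field poly poly" where
  "var_C = [:[:0, 1:]:]"

definition poly_to_ac :: "'a::field poly poly \<Rightarrow> 'a poly poly fract alg_closure" where
  "poly_to_ac p = to_ac (Fraction_Field.Fract p 1)"

text \<open>For \<open>n \<ge> 2\<close> the value of \<open>cyclotomic_hom n\<close> does not depend on the order of the two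
  roots, so the universal quantifier below does not overconstrain \<open>L\<close>.\<close>

definition lucas_atom :: "nat \<Rightarrow> 'a::field poly poly" where
  "lucas_atom n = (THE L. \<forall>\<alpha> \<beta>.
     [:poly_to_ac var_C, poly_to_ac var_B, 1:] = [:-\<alpha>, 1:] * [:-\<beta>, 1:] \<longrightarrow>
     poly_to_ac L = cyclotomic_hom n \<alpha> \<beta>)"


section \<open>The ring \<open>A\<close> and the inverse Frobenius operator\<close>

text \<open>\<open>ring_A = F[C] / (\<Phi>(C))\<close>, where \<open>\<Phi>\<close> is the cyclotomic polynomial of index \<open>CARD('a) - 1\<close>.
  Its elements are cosets, i.e. sets of polynomials in \<open>C\<close>.\<close>

definition ideal_A :: "'a::finite_field poly set" where
  "ideal_A = genideal (ring_of_type_algebra :: 'a poly ring) {cyclotomic (CARD('a) - 1)}"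

definition ring_A :: "'a::finite_field poly set ring" where
  "ring_A = (ring_of_type_algebra :: 'a poly ring) Quot ideal_A"

text \<open>\<open>A[B]\<close> is \<open>UP ring_A\<close>, whose elements are coefficient functions on \<open>nat\<close>.\<close>

definition proj_A :: "'a::finite_field poly poly \<Rightarrow> nat \<Rightarrow> 'a poly set" where
  "proj_A P = (\<lambda>i. ideal_A +>\<^bsub>ring_of_type_algebra\<^esub> Polynomial.coeff P i)"

definition even_polys_A :: "(nat \<Rightarrow> 'a::finite_field poly set) set" where
  "even_polys_A = {p \<in> carrier (UP ring_A). \<forall>i. odd i \<longrightarrow> p i = \<zero>\<^bsub>ring_A\<^esub>}"

definition inv_Frobenius :: "(nat \<Rightarrow> 'a::finite_field poly set) \<Rightarrow> nat \<Rightarrow> 'a poly set" where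
  "inv_Frobenius = (\<lambda>p\<in>even_polys_A. \<lambda>i. p (2 * i) [^]\<^bsub>ring_A\<^esub> (CARD('a) div 2))"


section \<open>Optimal determining polynomials\<close>

definition eval_C :: "'a::field poly poly \<Rightarrow> 'a \<Rightarrow> 'a poly" where
  "eval_C P c = map_poly (\<lambda>g. poly g c) P"

text \<open>Roots are taken in the algebraic closure, so that \<open>P(B,c)\<close> has no roots outside the field.\<close>

definition determines_primitive_quadratics :: "'a::finite_field poly poly \<Rightarrow> 'a \<Rightarrow> bool" where
  "determines_primitive_quadratics P c \<longleftrightarrow>
     Polynomial.lead_coeff (eval_C P c) = 1 \<and>
     squarefree (eval_C P c) \<and>
     {x. poly (map_poly to_ac (eval_C P c)) x = 0} = to_ac ` {b. primitive_polynomial [:c, b, 1:]}"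

definition optimal_determining_polynomial :: "'a::finite_field poly poly \<Rightarrow> bool" where
  "optimal_determining_polynomial P \<longleftrightarrow>
     (\<forall>c. primitive_element c \<longrightarrow>
        determines_primitive_quadratics P c \<and>
        eval_C P c = (\<Prod>b | primitive_polynomial [:c, b, 1:]. [:-b, 1:]))"

end

(* A palindromic integral polynomial of even degree 2k is a combination of the X^j (X+1)^(2(k-j)).
   For Phi_N with coefficients a_j this gives Lambda_N = sum_j a_j C^j B^(2(k-j)), hence
   P_q(b,c)^2 = sum_j a_j c^j b^(2(k-j)) = Phi_N^hom(alpha,beta), where alpha + beta = b and
   alpha beta = c.  So b is a root iff zeta = alpha/beta has order q+1.

   In that case beta^(q-1) = zeta, because both squares agree and the characteristic is two; thus
   beta^q = alpha, which puts b into F_q, and beta has order (q-1)(q+1).  Conversely, a generator g of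
   the multiplicative group of F_(q^2) with minimal polynomial X^2 + bX + c has conjugate g^q, and
   g^(q-1) has order q+1.  A double root would produce a double root zeta of Phi_N, which is
   separable. *)

theory Submission
  imports Defs
begin

section \<open>Polynomials\<close>

text \<open>Why \<open>P\<close> squares to the Lucas atom: at \<open>c\<close>, a root of the
  cyclotomic polynomial of index q-1, evaluation factors through A, so the choice of preimage is
  immaterial. There the inverse Frobenius halves each exponent of B and replaces each coefficient,
  now an element of F_q, by its square root, its power q/2. Squaring is additive and undoes both.

  The coefficients a_j are found over the integers because they are needed in two unrelated fields:
  the closure of F_q(B,C), where \<open>lucas_atom\<close> is defined by a description, and the
  closure of F_q, where B and C are specialised.

  The obstacle for separability is that the Lucas atom is a polynomial in B^2, so its derivative in
  B is zero and says nothing about P. Instead the square of x R'(x), for R = P(B,c), is compared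
  with X Phi'(X): both are the summands of the values themselves, weighted by k-j and by j
  respectively.\<close>

locale coeff_hom =
  fixes h :: "'r::comm_ring_1 \<Rightarrow> 's::comm_ring_1"
  assumes hom_0 [simp]: "h 0 = 0" and hom_1 [simp]: "h 1 = 1"
    and hom_add: "h (x + y) = h x + h y" and hom_mult: "h (x * y) = h x * h y"
begin

lemma map_poly_add: "map_poly h (p + q) = map_poly h p + map_poly h q"
  by (intro poly_eqI) (simp add: coeff_map_poly hom_add)

lemma hom_uminus: "h (- x) = - h x"
  using hom_add[of x "-x"] by (simp add: eq_neg_iff_add_eq_0 add.commute)

lemma hom_diff: "h (x - y) = h x - h y"
  using hom_add[of x "-y"] by (simp add: hom_uminus)

lemma hom_of_nat: "h (of_nat n) = of_nat n"
  by (induction n) (simp_all add: hom_add)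

lemma hom_of_int: "h (of_int n) = of_int n"
  by (cases n rule: int_diff_cases) (simp add: hom_diff hom_of_nat)

lemma hom_power: "h (x ^ n) = h x ^ n"
  by (induction n) (simp_all add: hom_mult)

lemma hom_sum: "h (\<Sum>x\<in>A. f x) = (\<Sum>x\<in>A. h (f x))"
  by (induction A rule: infinite_finite_induct) (simp_all add: hom_add)

lemma map_poly_diff: "map_poly h (p - q) = map_poly h p - map_poly h q"
  by (intro poly_eqI) (simp add: coeff_map_poly hom_diff)

lemma map_poly_smult_hom: "map_poly h (smult c p) = smult (h c) (map_poly h p)"
  by (intro poly_eqI) (simp add: coeff_map_poly hom_mult)

lemma map_poly_pCons_hom: "map_poly h (pCons c p) = pCons (h c) (map_poly h p)"
  by (simp add: map_poly_pCons)

lemma map_poly_mult: "map_poly h (p * q) = map_poly h p * map_poly h q"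
  by (induction p) (simp_all add: map_poly_add map_poly_smult_hom map_poly_pCons_hom)

lemma map_poly_prod: "map_poly h (\<Prod>x\<in>A. f x) = (\<Prod>x\<in>A. map_poly h (f x))"
  by (induction A rule: infinite_finite_induct) (simp_all add: map_poly_mult)

lemma map_poly_power: "map_poly h (p ^ n) = map_poly h p ^ n"
  by (induction n) (simp_all add: map_poly_mult)

lemma map_poly_sum: "map_poly h (\<Sum>x\<in>A. f x) = (\<Sum>x\<in>A. map_poly h (f x))"
  by (induction A rule: infinite_finite_induct) (simp_all add: map_poly_add)

lemma poly_map_poly: "poly (map_poly h p) (h x) = h (poly p x)"
  by (induction p) (simp_all add: map_poly_pCons_hom hom_add hom_mult)

end

interpretation of_int_hom: coeff_hom "of_int :: int \<Rightarrow> 'a::comm_ring_1"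
  by unfold_locales auto

interpretation to_ac_hom: coeff_hom "to_ac :: 'a::field \<Rightarrow> 'a alg_closure"
  by unfold_locales auto

lemma lead_coeff_map_poly_of_int:
  assumes "Polynomial.lead_coeff p = 1"
  shows "Polynomial.lead_coeff (map_poly of_int p :: 'a::comm_ring_1 poly) = 1"
    and "Polynomial.degree (map_poly of_int p :: 'a poly) = Polynomial.degree p"
proof -
  show "Polynomial.degree (map_poly of_int p :: 'a poly) = Polynomial.degree p"
    by (rule map_poly_degree_eq) (use assms in auto)
  with assms show "Polynomial.lead_coeff (map_poly of_int p :: 'a poly) = 1"
    by (simp add: coeff_map_poly)
qed

text \<open>If the two polynomials differed, their difference would have \<open>card S\<close>
  roots, hence at least that degree, although the leading terms cancel.\<close>

lemma monic_eq_prod_roots: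
  fixes p :: "'a::field poly"
  assumes "finite S" "\<And>x. x \<in> S \<Longrightarrow> poly p x = 0" "Polynomial.lead_coeff p = 1"
    and deg: "Polynomial.degree p = card S"
  shows "p = (\<Prod>x\<in>S. [:-x, 1:])"
proof (rule ccontr)
  let ?q = "\<Prod>x\<in>S. [:-x, 1:]"
  assume neq: "p \<noteq> ?q"
  have dq: "Polynomial.degree ?q = card S"
    by (subst degree_prod_eq_sum_degree) auto
  have lq: "Polynomial.lead_coeff ?q = 1"
    by (simp add: lead_coeff_prod)
  have "card S \<le> card {x. poly (p - ?q) x = 0}"
    using assms neq by (intro card_mono poly_roots_finite) (auto simp: poly_prod)
  also have "\<dots> \<le> Polynomial.degree (p - ?q)"
    using neq by (intro card_poly_roots_bound) auto
  finally have "card S \<le> Polynomial.degree (p - ?q)" .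
  moreover have "Polynomial.degree (p - ?q) \<le> card S"
    using deg dq by (intro degree_diff_le) auto
  ultimately have "Polynomial.coeff (p - ?q) (card S) \<noteq> 0"
    using neq by (metis le_antisym leading_coeff_0_iff right_minus_eq)
  thus False
    using assms(3) lq deg dq by simp
qed

section \<open>Multiplicative order\<close>

text \<open>Stated by divisibility, so that orders are unique and combine by coprimality; index 0
  means infinite order. \<open>has_order_iff_least\<close> recovers the least-exponent form used in
  \<open>cyclotomic_complex\<close>.\<close>

definition has_order :: "nat \<Rightarrow> 'a::monoid_mult \<Rightarrow> bool" where
  "has_order n z \<longleftrightarrow> (\<forall>k. z ^ k = 1 \<longleftrightarrow> n dvd k)"

lemma has_order_iff_least:
  assumes "n > 0"
  shows "has_order n z \<longleftrightarrow> z ^ n = 1 \<and> (\<forall>k\<in>{1..<n}. z ^ k \<noteq> 1)"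
proof
  assume *: "z ^ n = 1 \<and> (\<forall>k\<in>{1..<n}. z ^ k \<noteq> 1)"
  have "z ^ k = z ^ (k mod n)" for k
  proof -
    have "z ^ k = (z ^ n) ^ (k div n) * z ^ (k mod n)"
      by (simp flip: power_mult power_add)
    with * show ?thesis by simp
  qed
  moreover have "z ^ (k mod n) = 1 \<longleftrightarrow> k mod n = 0" for k
    using * mod_less_divisor[OF assms, of k] by (cases "k mod n = 0") auto
  ultimately show "has_order n z"
    unfolding has_order_def by (metis dvd_eq_mod_eq_0)
qed (use assms in \<open>auto simp: has_order_def dest: dvd_imp_le\<close>)

lemma has_order_power: "has_order n z \<Longrightarrow> z ^ n = 1"
  by (simp only: has_order_def dvd_refl)

lemma has_order_unique: "has_order m z \<Longrightarrow> has_order n z \<Longrightarrow> m = n"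
  by (metis has_order_def dvd_antisym dvd_refl)

lemma ex_has_order:
  assumes "n > 0" "z ^ n = 1"
  shows "\<exists>d. d dvd n \<and> has_order d z"
proof -
  define d where "d = (LEAST d. d > 0 \<and> z ^ d = 1)"
  have "d > 0 \<and> z ^ d = 1"
    unfolding d_def by (rule LeastI[of _ n]) (use assms in auto)
  moreover have "\<forall>k\<in>{1..<d}. z ^ k \<noteq> 1"
    unfolding d_def using not_less_Least by fastforce
  ultimately have "has_order d z"
    using has_order_iff_least by blast
  with assms show ?thesis
    by (auto simp: has_order_def)
qed

section \<open>Cyclotomic polynomials\<close>

lemma cyclotomic_complex_eq:
  "n > 0 \<Longrightarrow> cyclotomic_complex n = (\<Prod>z | has_order n z. [:-z, 1:])"
  by (simp add: cyclotomic_complex_def has_order_iff_least)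

lemma finite_has_order: "n > 0 \<Longrightarrow> finite {z::complex. has_order n z}"
  by (rule finite_subset[OF _ finite_roots_unity[of n]]) (auto simp: has_order_power)

lemma degree_xn_1: "n > 0 \<Longrightarrow> Polynomial.degree (monom 1 n - 1 :: 'a::comm_ring_1 poly) = n"
  by (subst diff_conv_add_uminus, subst degree_add_eq_left) (auto simp: degree_monom_eq)

lemma lead_coeff_xn_1: "n > 0 \<Longrightarrow> Polynomial.lead_coeff (monom 1 n - 1 :: 'a::comm_ring_1 poly) = 1"
  by (simp add: degree_xn_1)

text \<open>The n-th roots of unity are sorted by their exact order.\<close>

lemma prod_cyclotomic_complex:
  assumes "n > 0"
  shows "(\<Prod>d | d dvd n. cyclotomic_complex d) = monom 1 n - 1"
proof -
  have "(\<Prod>d | d dvd n. cyclotomic_complex d) = (\<Prod>d | d dvd n. \<Prod>z | has_order d z. [:-z, 1:])"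
    using assms by (intro prod.cong) (auto simp: cyclotomic_complex_eq dvd_pos_nat)
  also have "\<dots> = (\<Prod>z\<in>(\<Union>d\<in>{d. d dvd n}. {z. has_order d z}). [:-z, 1:])"
    using assms by (intro prod.UNION_disjoint [symmetric])
      (auto simp: finite_has_order dvd_pos_nat dest: has_order_unique)
  also have "(\<Union>d\<in>{d. d dvd n}. {z::complex. has_order d z}) = {z. z ^ n = 1}"
    using ex_has_order[OF assms] by (auto simp: has_order_def)
  also have "(\<Prod>z\<in>{z. z ^ n = 1}. [:-z, 1:]) = (monom 1 n - 1 :: complex poly)"
    using assms
    by (intro monic_eq_prod_roots[symmetric] lead_coeff_xn_1 finite_roots_unity)
       (auto simp: poly_monom degree_xn_1 card_roots_unity_eq)
  finally show ?thesis .
qed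

lemma map_poly_of_int_complex_inj:
  "map_poly of_int p = (map_poly of_int r :: complex poly) \<Longrightarrow> p = r"
  by (metis (no_types, lifting) coeff_map_poly of_int_0 of_int_eq_iff poly_eqI)

lemma lead_coeff_cyclotomic_complex: "Polynomial.lead_coeff (cyclotomic_complex n) = 1"
  by (simp add: cyclotomic_complex_def lead_coeff_prod)

lemma divisors_insert:
  "n > 0 \<Longrightarrow> {d. d dvd n} = insert n {d. d dvd n \<and> d < (n::nat)}"
  by (auto dest: dvd_imp_le)

lemma prod_divisors:
  "n > 0 \<Longrightarrow> (\<Prod>d | d dvd n. f d) = f n * (\<Prod>d | d dvd n \<and> d < (n::nat). f d)"
  by (subst divisors_insert) auto

text \<open>Induction on \<open>n\<close>: the product \<open>g\<close> over the proper divisors is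
  monic with integral coefficients, so X^n - 1 can be divided by it with integral quotient and
  remainder. Over the complex numbers \<open>g\<close> divides exactly, which forces the remainder
  to vanish by degree.\<close>

lemma cyclotomic_complex_integral:
  assumes "n > 0"
  shows "\<exists>p. map_poly of_int p = cyclotomic_complex n \<and> Polynomial.lead_coeff p = 1"
  using assms
proof (induction n rule: less_induct)
  case (less n)
  then obtain f where
    f: "\<And>d. d dvd n \<Longrightarrow> d < n \<Longrightarrow> map_poly of_int (f d) = cyclotomic_complex d"
       "\<And>d. d dvd n \<Longrightarrow> d < n \<Longrightarrow> Polynomial.lead_coeff (f d) = 1"
    by (metis dvd_pos_nat)
  define g where "g = (\<Prod>d | d dvd n \<and> d < n. f d)"
  let ?h = "map_poly of_int :: int poly \<Rightarrow> complex poly"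
  have lead_g: "Polynomial.lead_coeff g = 1"
    using f by (auto simp: g_def lead_coeff_prod)
  hence g0: "g \<noteq> 0" by auto
  \<comment> \<open>Pseudo-division scales the dividend by a power of the leading coefficient of
    \<open>g\<close>; as this is 1, it is honest division.\<close>
  obtain s r where sr: "pseudo_divmod (monom 1 n - 1) g = (s, r)"
    by (cases "pseudo_divmod (monom 1 n - 1) g")
  have div: "monom 1 n - 1 = g * s + r" and deg_r: "r = 0 \<or> Polynomial.degree r < Polynomial.degree g"
    using pseudo_divmod[OF g0 sr] lead_g by auto
  have "cyclotomic_complex n * ?h g = ?h (monom 1 n - 1)"
    using prod_cyclotomic_complex[OF less.prems] f less.prems
    by (simp add: prod_divisors g_def of_int_hom.map_poly_prod of_int_hom.map_poly_diff map_poly_monom)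
  also have "\<dots> = ?h g * ?h s + ?h r"
    unfolding div by (simp add: of_int_hom.map_poly_add of_int_hom.map_poly_mult)
  finally have *: "?h g * (cyclotomic_complex n - ?h s) = ?h r"
    by (simp add: algebra_simps)
  have "cyclotomic_complex n = ?h s"
  proof (rule ccontr)
    assume "cyclotomic_complex n \<noteq> ?h s"
    hence "Polynomial.degree (?h r) \<ge> Polynomial.degree (?h g)" "?h r \<noteq> 0"
      using lead_coeff_map_poly_of_int(1)[OF lead_g, where 'a = complex]
      unfolding *[symmetric] by (subst degree_mult_eq, auto)
    thus False
      using deg_r lead_coeff_map_poly_of_int(2)[OF lead_g, where 'a = complex]
        map_poly_degree_leq[of "of_int :: int \<Rightarrow> complex" r] by (auto simp: not_le[symmetric])
  qed
  moreover from this have "of_int (Polynomial.lead_coeff s) = (1::complex)"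
    using lead_coeff_cyclotomic_complex[of n]
    by (metis coeff_map_poly degree_map_poly of_int_0 of_int_eq_0_iff)
  ultimately show ?case
    by (metis of_int_eq_1_iff)
qed

lemma cyclotomic_int:
  assumes "n > 0"
  shows map_poly_cyclotomic_int: "map_poly of_int (cyclotomic_int n) = cyclotomic_complex n"
    and lead_coeff_cyclotomic_int: "Polynomial.lead_coeff (cyclotomic_int n) = 1"
proof -
  obtain p where p: "map_poly of_int p = cyclotomic_complex n" "Polynomial.lead_coeff p = 1"
    using cyclotomic_complex_integral[OF assms] by blast
  have "cyclotomic_int n = p"
    unfolding cyclotomic_int_def
    unfolding p(1)[symmetric] by (rule the_equality) (simp, erule map_poly_of_int_complex_inj)
  with p show "map_poly of_int (cyclotomic_int n) = cyclotomic_complex n"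
    "Polynomial.lead_coeff (cyclotomic_int n) = 1" by auto
qed

lemma prod_cyclotomic_int:
  assumes "n > 0"
  shows "(\<Prod>d | d dvd n. cyclotomic_int d) = monom 1 n - 1"
proof (rule map_poly_of_int_complex_inj)
  have "map_poly of_int (\<Prod>d | d dvd n. cyclotomic_int d) = (\<Prod>d | d dvd n. cyclotomic_complex d)"
    unfolding of_int_hom.map_poly_prod
    by (intro prod.cong) (use assms in \<open>auto simp: map_poly_cyclotomic_int dvd_pos_nat\<close>)
  thus "map_poly of_int (\<Prod>d | d dvd n. cyclotomic_int d) = (map_poly of_int (monom 1 n - 1) :: complex poly)"
    using assms by (simp add: prod_cyclotomic_complex of_int_hom.map_poly_diff map_poly_monom)
qed

lemma prod_cyclotomic:
  assumes "n > 0"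
  shows "(\<Prod>d | d dvd n. cyclotomic d) = (monom 1 n - 1 :: 'a::comm_ring_1 poly)"
  using arg_cong[OF prod_cyclotomic_int[OF assms], of "map_poly (of_int :: int \<Rightarrow> 'a)"]
  unfolding cyclotomic_def of_int_hom.map_poly_prod of_int_hom.map_poly_diff
  by (simp add: map_poly_monom)

text \<open>Degrees and totients have the same divisor sum, namely \<open>n\<close>; induction
  cancels the proper divisors.\<close>

lemma degree_cyclotomic_int: "n > 0 \<Longrightarrow> Polynomial.degree (cyclotomic_int n) = totient n"
proof (induction n rule: less_induct)
  case (less n)
  have fin: "finite {d. d dvd n}" using less.prems by simp
  have nz: "cyclotomic_int d \<noteq> 0" if "d dvd n" for d
    using lead_coeff_cyclotomic_int[of d] that less.prems by (auto simp: dvd_pos_nat)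
  have "Polynomial.degree (\<Prod>d | d dvd n. cyclotomic_int d) = (\<Sum>d | d dvd n. Polynomial.degree (cyclotomic_int d))"
    by (subst degree_prod_eq_sum_degree) (use nz in auto)
  hence "(\<Sum>d | d dvd n. Polynomial.degree (cyclotomic_int d)) = (\<Sum>d | d dvd n. totient d)"
    using less.prems by (simp add: prod_cyclotomic_int degree_xn_1 totient_divisor_sum)
  moreover have "(\<Sum>d | d dvd n \<and> d < n. Polynomial.degree (cyclotomic_int d)) =
      (\<Sum>d | d dvd n \<and> d < n. totient d)"
    using less by (intro sum.cong) (auto simp: dvd_pos_nat)
  ultimately show ?case
    using less.prems fin by (simp add: divisors_insert)
qed

lemma cyclotomic_int_1: "cyclotomic_int 1 = [:-1, 1:]"
proof -
  have "monom 1 1 - 1 = [:-1, 1::int:]"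
    by (intro poly_eqI) (auto simp: coeff_pCons split: nat.splits)
  with prod_cyclotomic_int[of 1] show ?thesis
    by simp
qed

text \<open>Reversing coefficients negates X^n - 1 and also its factor X - 1, and by induction it
  fixes the factors of the other proper divisors. The two signs cancel.\<close>

lemma reflect_cyclotomic_int: "n \<ge> 2 \<Longrightarrow> reflect_poly (cyclotomic_int n) = cyclotomic_int n"
proof (induction n rule: less_induct)
  case (less n)
  define D where "D = {d. d dvd n \<and> d < n \<and> d \<noteq> 1}"
  have fin: "finite D" using less.prems by (auto simp: D_def)
  have "{d. d dvd n} = insert n (insert 1 D)" "n \<notin> insert 1 D" "1 \<notin> D"
    using less.prems by (auto simp: D_def dest: dvd_imp_le)
  with fin have eq: "monom 1 n - 1 = cyclotomic_int n * (cyclotomic_int 1 * (\<Prod>d\<in>D. cyclotomic_int d))"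
    using prod_cyclotomic_int[of n] less.prems by simp
  have refl: "reflect_poly (monom 1 n - 1 :: int poly) = - (monom 1 n - 1)"
    using less.prems
    by (intro poly_eqI) (auto simp: coeff_reflect_poly degree_xn_1 split: if_splits)
  have IH: "reflect_poly (cyclotomic_int d) = cyclotomic_int d" if "d \<in> D" for d
    using that less.prems by (intro less.IH) (auto simp: D_def intro: Suc_leI gr0I)
  have refl_1: "reflect_poly (cyclotomic_int 1) = - cyclotomic_int 1"
    unfolding cyclotomic_int_1 by (simp add: reflect_poly_pCons)
  have nz: "cyclotomic_int 1 * (\<Prod>d\<in>D. cyclotomic_int d) \<noteq> 0"
  proof
    assume "cyclotomic_int 1 * (\<Prod>d\<in>D. cyclotomic_int d) = 0"
    with eq have "(monom 1 n - 1 :: int poly) = 0" by simp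
    with degree_xn_1[of n, where 'a = int] less.prems show False by simp
  qed
  have "reflect_poly (cyclotomic_int n) * (- cyclotomic_int 1 * (\<Prod>d\<in>D. cyclotomic_int d)) =
        reflect_poly (monom 1 n - 1)"
    unfolding eq reflect_poly_mult reflect_poly_prod
    by (simp only: refl_1 IH cong: prod.cong)
  also have "\<dots> = cyclotomic_int n * (- cyclotomic_int 1 * (\<Prod>d\<in>D. cyclotomic_int d))"
    using refl eq by simp
  finally show ?case
    using nz by simp
qed

lemma degree_cyclotomic:
  "n > 0 \<Longrightarrow> Polynomial.degree (cyclotomic n :: 'a::comm_ring_1 poly) = totient n"
  unfolding cyclotomic_def
  by (subst lead_coeff_map_poly_of_int(2)[OF lead_coeff_cyclotomic_int]) (simp_all add: degree_cyclotomic_int)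

text \<open>Subtracting the constant coefficient times (X+1)^(2k+2) keeps the symmetry and kills the
  constant term, hence also the top term. What remains is X times a palindromic polynomial for
  \<open>k\<close>. The value \<open>a 0\<close> is recorded because it becomes the leading
  coefficient of the determining polynomial.\<close>

lemma palindromic_decomposition:
  fixes f :: "'a::comm_ring_1 poly"
  assumes "Polynomial.degree f \<le> 2 * k"
    and "\<And>i. i \<le> 2 * k \<Longrightarrow> Polynomial.coeff f i = Polynomial.coeff f (2 * k - i)"
  shows "\<exists>a. a 0 = Polynomial.coeff f 0 \<and> f = (\<Sum>j\<le>k. monom (a j) j * [:1, 1:] ^ (2 * (k - j)))"
  using assms
proof (induction k arbitrary: f)
  case 0
  then have "f = monom (Polynomial.coeff f 0) 0"
    by (simp add: monom_0 degree_0_id)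
  thus ?case
    by (intro exI[of _ "\<lambda>_. Polynomial.coeff f 0"]) simp
next
  case (Suc k)
  define g where "g = f - smult (Polynomial.coeff f 0) ([:1, 1:] ^ (2 * Suc k))"
  have coeff_pow: "Polynomial.coeff ([:1, 1:] ^ m :: 'a poly) i = of_nat (m choose i)" for m i
    by (cases "i \<le> m") (simp_all add: coeff_linear_poly_power coeff_eq_0 degree_linear_power binomial_eq_0)
  have coeff_g: "Polynomial.coeff g i = Polynomial.coeff f i - Polynomial.coeff f 0 * of_nat (2 * Suc k choose i)" for i
    by (simp only: g_def coeff_diff coeff_smult coeff_pow)
  have sym_g: "Polynomial.coeff g i = Polynomial.coeff g (2 * Suc k - i)" if "i \<le> 2 * Suc k" for i
    unfolding coeff_g using Suc.prems(2)[OF that] binomial_symmetric[OF that] by simp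
  have g_0: "Polynomial.coeff g 0 = 0" by (simp add: coeff_g)
  then obtain h where h: "g = pCons 0 h"
    by (metis coeff_pCons_0 pCons_cases)
  have g_large: "Polynomial.coeff g i = 0" if "i \<ge> 2 * Suc k" for i
  proof (cases "i = 2 * Suc k")
    case True
    with sym_g[of i] g_0 show ?thesis by simp
  next
    case False
    with that have "Polynomial.coeff f i = 0" "2 * Suc k choose i = 0"
      using Suc.prems(1) by (auto intro: coeff_eq_0)
    thus ?thesis by (simp only: coeff_g of_nat_0 mult_zero_right diff_self)
  qed
  have coeff_h: "Polynomial.coeff h i = Polynomial.coeff g (Suc i)" for i
    by (simp add: h)
  have "\<exists>b. b 0 = Polynomial.coeff h 0 \<and> h = (\<Sum>j\<le>k. monom (b j) j * [:1, 1:] ^ (2 * (k - j)))"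
  proof (rule Suc.IH)
    show "Polynomial.degree h \<le> 2 * k"
      by (rule degree_le) (auto simp: coeff_h g_large)
    show "Polynomial.coeff h i = Polynomial.coeff h (2 * k - i)" if "i \<le> 2 * k" for i
      using sym_g[of "Suc i"] that by (simp add: coeff_h Suc_diff_le)
  qed
  then obtain b where b: "h = (\<Sum>j\<le>k. monom (b j) j * [:1, 1:] ^ (2 * (k - j)))"
    by blast
  define a where "a = case_nat (Polynomial.coeff f 0) b"
  have "f = smult (Polynomial.coeff f 0) ([:1, 1:] ^ (2 * Suc k)) + monom 1 1 * h"
    using h by (simp add: g_def monom_altdef algebra_simps)
  also have "monom 1 1 * h = (\<Sum>j\<le>k. monom (b j) (Suc j) * [:1, 1:] ^ (2 * (k - j)))"
    by (simp only: b sum_distrib_left mult.assoc[symmetric] mult_monom) simp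
  also have "smult (Polynomial.coeff f 0) ([:1, 1:] ^ (2 * Suc k)) + \<dots> =
    (\<Sum>j\<le>Suc k. monom (a j) j * [:1, 1:] ^ (2 * (Suc k - j)))"
    unfolding sum.atMost_Suc_shift by (simp add: a_def monom_0)
  finally show ?case
    by (intro exI[of _ a]) (simp add: a_def)
qed

lemma cyclotomic_int_decomposition:
  assumes "n > 2"
  obtains a k where "totient n = 2 * k" "a 0 = 1"
    "cyclotomic_int n = (\<Sum>j\<le>k. monom (a j) j * [:1, 1:] ^ (2 * (k - j)))"
proof -
  let ?f = "cyclotomic_int n"
  obtain k where k: "totient n = 2 * k"
    using totient_even[OF assms] by (elim evenE)
  have deg: "Polynomial.degree ?f = 2 * k"
    using degree_cyclotomic_int[of n] assms k by simp
  have refl: "reflect_poly ?f = ?f"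
    using assms by (intro reflect_cyclotomic_int) simp
  have sym: "Polynomial.coeff ?f i = Polynomial.coeff ?f (2 * k - i)" if "i \<le> 2 * k" for i
    using that by (subst refl[symmetric]) (simp add: coeff_reflect_poly deg)
  obtain a where a: "a 0 = Polynomial.coeff ?f 0"
    "?f = (\<Sum>j\<le>k. monom (a j) j * [:1, 1:] ^ (2 * (k - j)))"
    using palindromic_decomposition[OF eq_refl[OF deg] sym] by blast
  have "Polynomial.coeff ?f 0 = 1"
    using sym[of 0] lead_coeff_cyclotomic_int[of n] assms deg by simp
  with a(1) show ?thesis
    by (intro that[OF k _ a(2)]) simp
qed

lemma cyclotomic_decomposition:
  assumes "cyclotomic_int n = (\<Sum>j\<le>k. monom (a j) j * [:1, 1:] ^ (2 * (k - j)))"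
  shows "(cyclotomic n :: 'a::comm_ring_1 poly) =
    (\<Sum>j\<le>k. monom (of_int (a j)) j * [:1, 1:] ^ (2 * (k - j)))"
  unfolding cyclotomic_def assms
  by (simp add: of_int_hom.map_poly_sum of_int_hom.map_poly_mult of_int_hom.map_poly_power
      map_poly_monom map_poly_pCons)

section \<open>Lucas atoms\<close>

text \<open>The factor \<open>\<beta> ^ (2 * k)\<close> is spent in three parts: \<open>j\<close>
  powers clear the denominators of \<open>(\<alpha> / \<beta>) ^ j\<close>, another \<open>j\<close>
  stay and pair with \<open>\<alpha> ^ j\<close>, and the rest enter the power of the sum. The
  coefficient \<open>c\<close> is free so that the weighted sum of the derivative can be treated
  too.\<close>

lemma homogenize_summand:
  fixes \<alpha> \<beta> :: "'a::field"
  assumes "\<beta> \<noteq> 0" "j \<le> k"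
  shows "\<beta> ^ (2 * k) * (c * (\<alpha> / \<beta>) ^ j * (1 + \<alpha> / \<beta>) ^ (2 * (k - j))) =
    c * (\<alpha> * \<beta>) ^ j * (\<alpha> + \<beta>) ^ (2 * (k - j))"
proof -
  let ?m = "2 * (k - j)"
  have "\<beta> ^ (2 * k) = \<beta> ^ j * \<beta> ^ j * \<beta> ^ ?m"
    using assms(2) by (simp flip: power_add mult_2 distrib_left)
  hence "\<beta> ^ (2 * k) * (c * (\<alpha> / \<beta>) ^ j * (1 + \<alpha> / \<beta>) ^ ?m) =
      c * (\<beta> ^ j * (\<alpha> / \<beta>) ^ j) * \<beta> ^ j * (\<beta> ^ ?m * (1 + \<alpha> / \<beta>) ^ ?m)"
    by (simp only: ac_simps)
  also have "\<beta> ^ j * (\<alpha> / \<beta>) ^ j = \<alpha> ^ j"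
    using assms(1) by (simp flip: power_mult_distrib)
  also have "\<beta> ^ ?m * (1 + \<alpha> / \<beta>) ^ ?m = (\<beta> * (1 + \<alpha> / \<beta>)) ^ ?m"
    by (simp only: power_mult_distrib)
  also have "\<beta> * (1 + \<alpha> / \<beta>) = \<alpha> + \<beta>"
    using assms(1) by (simp add: field_simps)
  finally show ?thesis
    by (simp only: power_mult_distrib ac_simps)
qed

lemma cyclotomic_hom_eq:
  fixes \<alpha> \<beta> :: "'a::field"
  assumes "\<beta> \<noteq> 0" "totient n = 2 * k"
    and "cyclotomic n = (\<Sum>j\<le>k. monom (c j) j * [:1, 1:] ^ (2 * (k - j)))"
  shows "cyclotomic_hom n \<alpha> \<beta> = (\<Sum>j\<le>k. c j * (\<alpha> * \<beta>) ^ j * (\<alpha> + \<beta>) ^ (2 * (k - j)))"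
proof -
  have "poly [:1, 1:] (\<alpha> / \<beta>) = 1 + \<alpha> / \<beta>"
    by simp
  thus ?thesis
    by (simp only: cyclotomic_hom_def assms(2,3) poly_sum poly_mult poly_power poly_monom sum_distrib_left)
      (intro sum.cong refl homogenize_summand assms(1), simp)
qed

lemma Fract_1_simps:
  "Fraction_Field.Fract (p + q) 1 = Fraction_Field.Fract p 1 + Fraction_Field.Fract q 1"
  "Fraction_Field.Fract (p * q) 1 = Fraction_Field.Fract p 1 * Fraction_Field.Fract q 1"
  by simp_all

interpretation poly_to_ac: coeff_hom "poly_to_ac :: 'a::field poly poly \<Rightarrow> _"
proof
  show "poly_to_ac (0 :: 'a poly poly) = 0" "poly_to_ac (1 :: 'a poly poly) = 1"
    by (simp_all add: poly_to_ac_def flip: Zero_fract_def One_fract_def)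
qed (simp_all add: poly_to_ac_def Fract_1_simps del: Fraction_Field.add_fract Fraction_Field.mult_fract)

lemma poly_to_ac_eq_iff: "poly_to_ac p = poly_to_ac q \<longleftrightarrow> p = q"
  by (simp add: poly_to_ac_def eq_fract)

lemma quadratic_splits:
  fixes b c :: "'a::alg_closed_field"
  shows "\<exists>\<alpha> \<beta>. [:c, b, 1:] = [:-\<alpha>, 1:] * [:-\<beta>, 1:]"
proof -
  obtain x where "poly [:c, b, 1:] x = 0"
    using alg_closed_imp_poly_has_root[of "[:c, b, 1:]"] by auto
  hence "[:c, b, 1:] = [:-x, 1:] * [:-(-b - x), 1:]"
    by (simp add: algebra_simps eq_neg_iff_add_eq_0)
  thus ?thesis by blast
qed

text \<open>Here the sum of the roots is -B, but only even powers of it occur, so the sign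
  disappears in every characteristic. Uniqueness in the description comes from injectivity of
  \<open>poly_to_ac\<close>.\<close>

lemma lucas_atom_eq:
  assumes "totient n = 2 * k"
    and "(cyclotomic n :: 'a::field poly poly fract alg_closure poly) =
       (\<Sum>j\<le>k. monom (of_int (a j)) j * [:1, 1:] ^ (2 * (k - j)))"
  shows "(lucas_atom n :: 'a poly poly) = (\<Sum>j\<le>k. of_int (a j) * var_C ^ j * var_B ^ (2 * (k - j)))"
    (is "_ = ?L")
proof -
  have *: "poly_to_ac ?L = cyclotomic_hom n \<alpha> \<beta>"
    if "[:poly_to_ac var_C, poly_to_ac var_B, 1:] = [:-\<alpha>, 1:] * [:-\<beta>, 1:]" for \<alpha> \<beta>
  proof -
    have C: "poly_to_ac var_C = \<alpha> * \<beta>" and B: "poly_to_ac var_B = - (\<alpha> + \<beta>)"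
      using that by (simp_all add: algebra_simps)
    have "poly_to_ac (var_C :: 'a poly poly) \<noteq> poly_to_ac 0"
      by (subst poly_to_ac_eq_iff) (simp add: var_C_def)
    hence "\<beta> \<noteq> 0" by (auto simp: C)
    have neg: "(- (\<alpha> + \<beta>)) ^ (2 * m) = (\<alpha> + \<beta>) ^ (2 * m)" for m
      by (simp only: power_mult power2_minus)
    show ?thesis
      by (simp only: cyclotomic_hom_eq[OF \<open>\<beta> \<noteq> 0\<close> assms] poly_to_ac.hom_sum poly_to_ac.hom_mult
          poly_to_ac.hom_power poly_to_ac.hom_of_int B C neg)
  qed
  \<comment> \<open>A factorisation must exist, or the condition on \<open>L\<close> would be
    vacuous and determine nothing.\<close>
  obtain \<alpha> \<beta> where roots: "[:poly_to_ac (var_C :: 'a poly poly), poly_to_ac var_B, 1:] = [:-\<alpha>, 1:] * [:-\<beta>, 1:]"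
    using quadratic_splits by blast
  with * show ?thesis
    unfolding lucas_atom_def
  proof (intro the_equality)
    fix L :: "'a poly poly" assume "\<forall>\<alpha> \<beta>. [:poly_to_ac var_C, poly_to_ac var_B, 1:] = [:-\<alpha>, 1:] * [:-\<beta>, 1:] \<longrightarrow>
      poly_to_ac L = cyclotomic_hom n \<alpha> \<beta>"
    with * roots have "poly_to_ac L = poly_to_ac ?L" by simp
    thus "L = ?L" by (simp only: poly_to_ac_eq_iff)
  qed blast
qed

lemma of_int_poly_const: "of_int m = [:of_int m :: 'a::comm_ring_1:]"
  by (cases m rule: int_diff_cases) (simp add: of_nat_poly)

lemma coeff_lucas_atom:
  assumes "(lucas_atom n :: 'a::field poly poly) = (\<Sum>j\<le>k. of_int (a j) * var_C ^ j * var_B ^ (2 * (k - j)))"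
  shows "i \<le> k \<Longrightarrow> Polynomial.coeff (lucas_atom n :: 'a poly poly) (2 * i) = monom (of_int (a (k - i))) (k - i)"
    and "i > k \<Longrightarrow> Polynomial.coeff (lucas_atom n :: 'a poly poly) (2 * i) = 0"
    and "odd m \<Longrightarrow> Polynomial.coeff (lucas_atom n :: 'a poly poly) m = 0"
proof -
  have C: "(var_C :: 'a poly poly) ^ j = [:monom 1 j:]" for j
    by (induction j) (simp_all add: var_C_def monom_Suc one_pCons[symmetric])
  have B: "var_B ^ j = (monom 1 j :: 'a poly poly)" for j
    by (simp add: var_B_def monom_altdef)
  have summand: "of_int m * var_C ^ j * var_B ^ i = (monom (monom (of_int m) j) i :: 'a poly poly)" for m j i
    by (simp add: B C of_int_poly_const smult_monom)
  have coeff: "Polynomial.coeff (lucas_atom n :: 'a poly poly) m =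
      (\<Sum>j\<le>k. if 2 * (k - j) = m then monom (of_int (a j)) j else 0)" for m
    unfolding assms summand by (simp add: coeff_sum)
  show "i \<le> k \<Longrightarrow> Polynomial.coeff (lucas_atom n :: 'a poly poly) (2 * i) = monom (of_int (a (k - i))) (k - i)"
  proof -
    assume "i \<le> k"
    hence "(\<Sum>j\<le>k. if 2 * (k - j) = 2 * i then monom (of_int (a j)) j else 0) =
      (\<Sum>j\<le>k. if j = k - i then monom (of_int (a j)) j else 0 :: 'a poly)"
      by (intro sum.cong) auto
    thus ?thesis by (simp add: coeff)
  qed
  show "i > k \<Longrightarrow> Polynomial.coeff (lucas_atom n :: 'a poly poly) (2 * i) = 0"
    unfolding coeff by (intro sum.neutral) auto
  show "odd m \<Longrightarrow> Polynomial.coeff (lucas_atom n :: 'a poly poly) m = 0"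
    unfolding coeff by (intro sum.neutral) auto
qed

section \<open>Evaluation at primitive elements\<close>

lemma ring_of_type_algebra_sel [simp]:
  "carrier ring_of_type_algebra = UNIV" "monoid.mult ring_of_type_algebra = (*)"
  "one ring_of_type_algebra = 1" "ring.zero ring_of_type_algebra = 0" "add ring_of_type_algebra = (+)"
  by (simp_all add: ring_of_type_algebra_def)

lemma ideal_A_eq: "ideal_A = range (\<lambda>x. x * cyclotomic (CARD('a) - 1) :: 'a::finite_field poly)"
proof -
  interpret cring "ring_of_type_algebra :: 'a poly ring" by (rule cring_from_type_algebra)
  show ?thesis
    unfolding ideal_A_def using cgenideal_eq_genideal[of "cyclotomic (CARD('a) - 1)"]
    by (auto simp: cgenideal_def)
qed

lemma ideal_ideal_A: "ideal (ideal_A :: 'a::finite_field poly set) ring_of_type_algebra"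
proof -
  interpret cring "ring_of_type_algebra :: 'a poly ring" by (rule cring_from_type_algebra)
  show ?thesis
    unfolding ideal_A_def by (rule genideal_ideal) simp
qed

abbreviation coset_A :: "'a::finite_field poly \<Rightarrow> 'a poly set" where
  "coset_A x \<equiv> ideal_A +>\<^bsub>ring_of_type_algebra\<^esub> x"

text \<open>Elements of the ideal are multiples of the cyclotomic polynomial, so they vanish at its
  root \<open>c\<close> and evaluation there is well defined on cosets.\<close>

lemma coset_A_eqD:
  assumes "coset_A x = coset_A y" "poly (cyclotomic (CARD('a) - 1)) (c :: 'a::finite_field) = 0"
  shows "poly x c = poly y c"
proof -
  have "0 \<in> (ideal_A :: 'a poly set)"
    unfolding ideal_A_eq by (rule range_eqI[of _ _ 0]) simp
  hence "x \<in> coset_A x"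
    by (auto simp: a_r_coset_def')
  with assms show ?thesis
    by (auto simp: a_r_coset_def' ideal_A_eq)
qed

lemma coset_A_power:
  "coset_A x [^]\<^bsub>ring_A\<^esub> (n::nat) = coset_A (x ^ n)" for x :: "'a::finite_field poly"
proof (induction n)
  case 0
  show ?case by (simp add: nat_pow_def ring_A_def FactRing_def)
next
  case (Suc n)
  have "coset_A x [^]\<^bsub>ring_A\<^esub> Suc n = coset_A x [^]\<^bsub>ring_A\<^esub> n \<otimes>\<^bsub>ring_A\<^esub> coset_A x"
    by (simp add: nat_pow_def)
  also have "\<dots> = coset_A (x ^ n * x)"
    unfolding Suc.IH using ideal.rcoset_mult_add[OF ideal_ideal_A, of "x ^ n" x]
    by (simp add: ring_A_def FactRing_def)
  finally show ?case by (simp only: power_Suc2)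
qed

text \<open>Needed to unfold \<open>inv_Frobenius\<close>, a restricted function that is
  \<open>undefined\<close> outside \<open>even_polys_A\<close>.\<close>

lemma proj_A_even:
  assumes "\<And>i. odd i \<Longrightarrow> Polynomial.coeff L i = 0"
  shows "proj_A L \<in> even_polys_A"
proof -
  have zero: "\<zero>\<^bsub>ring_A\<^esub> = coset_A 0"
    by (simp add: ring_A_def FactRing_def a_r_coset_def')
  have "coset_A x \<in> carrier ring_A" for x
    by (auto simp: ring_A_def FactRing_def A_RCOSETS_def')
  moreover have "bound \<zero>\<^bsub>ring_A\<^esub> (Polynomial.degree L) (proj_A L)"
    by (intro bound.intro) (simp add: proj_A_def zero coeff_eq_0)
  ultimately show ?thesis
    using assms by (auto simp: even_polys_A_def UP_def up_def proj_A_def zero)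
qed

lemma inv_Frobenius_eval:
  fixes P :: "'a::finite_field poly poly"
  assumes "proj_A P = inv_Frobenius (proj_A L)"
    and "\<And>i. odd i \<Longrightarrow> Polynomial.coeff L i = 0"
    and "poly (cyclotomic (CARD('a) - 1)) c = 0"
  shows "poly (Polynomial.coeff P i) c = poly (Polynomial.coeff L (2 * i)) c ^ (CARD('a) div 2)"
proof -
  have "coset_A (Polynomial.coeff P i) = coset_A (Polynomial.coeff L (2 * i) ^ (CARD('a) div 2))"
    using fun_cong[OF assms(1), of i] proj_A_even[OF assms(2)]
    by (simp add: inv_Frobenius_def proj_A_def coset_A_power)
  from coset_A_eqD[OF this assms(3)] show ?thesis
    by simp
qed

section \<open>Roots of cyclotomic polynomials\<close>

text \<open>Since \<open>n\<close> is invertible, X^n - 1 has simple roots: its derivative vanishes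
  only at 0. At a root of the n-th factor the product rule then makes both that factor's derivative
  and the complementary product \<open>E\<close> nonzero. A smaller order would yield a root of
  \<open>E\<close>; conversely an element of order \<open>n\<close> is a root of some factor of
  index d dividing \<open>n\<close>, and x^d = 1 forces d = n.\<close>

lemma
  fixes x :: "'a::field"
  assumes "n > 0" "of_nat n \<noteq> (0::'a)"
  shows pderiv_cyclotomic_nz: "poly (cyclotomic n) x = 0 \<Longrightarrow> poly (pderiv (cyclotomic n)) x \<noteq> 0"
    and cyclotomic_root_iff: "poly (cyclotomic n) x = 0 \<longleftrightarrow> has_order n x"
proof -
  define E :: "'a poly" where "E = (\<Prod>d | d dvd n \<and> d < n. cyclotomic d)"
  have prod: "monom 1 n - 1 = cyclotomic n * E"
    using prod_cyclotomic[OF assms(1), where 'a = 'a] prod_divisors[OF assms(1), of "cyclotomic :: nat \<Rightarrow> 'a poly"]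
    by (simp add: E_def)
  have root: "x ^ m = 1" if "poly (cyclotomic d) x = 0" "d dvd m" "m > 0" for d m
  proof -
    have "poly (monom 1 m - 1) x = (\<Prod>d | d dvd m. poly (cyclotomic d) x)"
      by (simp only: prod_cyclotomic[OF that(3), symmetric] poly_prod)
    also have "\<dots> = 0"
      using that by (intro prod_zero) auto
    finally show ?thesis by (simp add: poly_monom)
  qed
  have ex_root: "\<exists>d. d dvd m \<and> poly (cyclotomic d) x = 0" if "x ^ m = 1" "m > 0" for m
  proof -
    have "(\<Prod>d | d dvd m. poly (cyclotomic d) x) = poly (monom 1 m - 1) x"
      by (simp only: prod_cyclotomic[OF that(2), symmetric] poly_prod)
    also have "\<dots> = 0"
      using that by (simp add: poly_monom)
    finally show ?thesis using that(2) by (auto simp: prod_zero_iff)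
  qed
  have sep: "poly (pderiv (cyclotomic n)) x \<noteq> 0 \<and> poly E x \<noteq> 0" if "poly (cyclotomic n) x = 0"
  proof -
    have "x \<noteq> 0"
      using root[OF that dvd_refl assms(1)] assms(1) by (auto simp: power_0_left)
    hence "poly (pderiv (monom 1 n - 1)) x \<noteq> 0"
      using assms by (simp add: pderiv_diff pderiv_monom poly_monom)
    with that show ?thesis
      unfolding prod by (auto simp: pderiv_mult)
  qed
  thus "poly (cyclotomic n) x = 0 \<Longrightarrow> poly (pderiv (cyclotomic n)) x \<noteq> 0"
    by blast
  show "poly (cyclotomic n) x = 0 \<longleftrightarrow> has_order n x"
  proof
    assume zero: "poly (cyclotomic n) x = 0"
    obtain d where d: "d dvd n" "has_order d x"
      using ex_has_order[OF assms(1) root[OF zero dvd_refl assms(1)]] by blast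
    have "d = n"
    proof (rule ccontr)
      assume "d \<noteq> n"
      with d assms(1) have "d < n" "d > 0"
        by (auto dest: dvd_imp_le intro: gr0I)
      with ex_root[OF has_order_power[OF d(2)]] obtain e where e: "e dvd d" "poly (cyclotomic e) x = 0"
        by blast
      have "e dvd n" "e < n"
        using dvd_trans[OF e(1) d(1)] dvd_imp_le[OF e(1) \<open>d > 0\<close>] \<open>d < n\<close> by simp_all
      with e(2) have "poly E x = 0"
        using assms(1) by (auto simp: E_def poly_prod intro!: prod_zero)
      with sep[OF zero] show False by simp
    qed
    with d show "has_order n x" by simp
  next
    assume ord: "has_order n x"
    then obtain d where d: "d dvd n" "poly (cyclotomic d) x = 0"
      using ex_root[OF has_order_power assms(1)] by blast
    hence "x ^ d = 1"
      using root assms(1) by (meson dvd_pos_nat dvd_refl)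
    with ord have "n dvd d"
      unfolding has_order_def by blast
    with d show "poly (cyclotomic n) x = 0"
      using dvd_antisym by blast
  qed
qed

lemma ex_has_order_alg_closed:
  assumes "n > 0" "of_nat n \<noteq> (0::'a::alg_closed_field)"
  shows "\<exists>x::'a. has_order n x"
proof -
  have "\<exists>x::'a. poly (cyclotomic n) x = 0"
    by (rule alg_closed_imp_poly_has_root) (simp add: degree_cyclotomic assms(1))
  thus ?thesis
    by (simp add: cyclotomic_root_iff assms)
qed

section \<open>Generators\<close>

lemma range_powi:
  fixes g :: "'a::field"
  assumes "has_order d g" "d > 0"
  shows "range (\<lambda>i::int. g powi i) = (\<lambda>i. g ^ i) ` {..<d}"
proof -
  have g0: "g \<noteq> 0"
    using has_order_power[OF assms(1)] assms(2) by (auto simp: power_0_left)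
  have *: "g powi i = g ^ nat (i mod int d)" for i
  proof -
    have "g powi i = g powi (int d * (i div int d) + i mod int d)"
      by simp
    also have "\<dots> = g powi (i mod int d)"
      unfolding power_int_add[OF disjI1[OF g0]] power_int_mult
      by (simp add: has_order_power[OF assms(1)])
    also have "\<dots> = g ^ nat (i mod int d)"
      using assms(2) by (simp add: power_int_def)
    finally show ?thesis .
  qed
  have "nat (i mod int d) < d" for i
    using assms(2) by (simp add: nat_less_iff)
  moreover have "g ^ i = g powi int i" for i
    by simp
  ultimately show ?thesis
    by (auto simp: * image_iff) (metis * lessThan_iff power_int_of_nat rangeI)
qed

lemma card_powers:
  fixes g :: "'a::field"
  assumes "has_order d g" "d > 0"
  shows "card ((\<lambda>i. g ^ i) ` {..<d}) = d"
proof -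
  have g0: "g \<noteq> 0"
    using has_order_power[OF assms(1)] assms(2) by (auto simp: power_0_left)
  have "inj_on (\<lambda>i. g ^ i) {..<d}"
  proof (rule linorder_inj_onI)
    fix i j assume ij: "i < j" "i \<in> {..<d}" "j \<in> {..<d}"
    show "g ^ i \<noteq> g ^ j"
    proof
      assume "g ^ i = g ^ j"
      moreover have "g ^ i * g ^ (j - i) = g ^ j"
        using ij by (simp flip: power_add)
      ultimately have "g ^ i * g ^ (j - i) = g ^ i * 1"
        by simp
      hence "g ^ (j - i) = 1"
        using g0 by simp
      hence "d dvd j - i"
        using assms(1) unfolding has_order_def by blast
      with ij show False by (auto dest: dvd_imp_le)
    qed
  qed auto
  thus ?thesis by (simp add: card_image)
qed

text \<open>The order d divides q-1, and the d distinct powers of \<open>c\<close> already fill the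
  q-1 nonzero elements.\<close>

lemma primitive_element_has_order:
  assumes "primitive_element (c::'a::finite_field)"
  shows "has_order (CARD('a) - 1) c"
proof -
  have gen: "range (\<lambda>i::int. c powi i) = UNIV - {0}"
    using assms by (simp add: primitive_element_def generates_nonzero_def)
  have card: "CARD('a) > 1"
    using card_mono[of UNIV "{0, 1 :: 'a}"] by simp
  have "c powi 1 \<in> UNIV - {0}"
    unfolding gen[symmetric] by (rule rangeI)
  hence "c \<noteq> 0" by simp
  have "c * c ^ (CARD('a) - 1) = c * 1"
    using card finite_field_power_card_eq_same[of c] by (cases "CARD('a)") auto
  hence "c ^ (CARD('a) - 1) = 1"
    using \<open>c \<noteq> 0\<close> by simp
  then obtain d where d: "d dvd CARD('a) - 1" "has_order d c"
    using card ex_has_order[of "CARD('a) - 1" c] by auto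
  hence "d > 0" using card by (auto intro: gr0I)
  have "card (UNIV - {0 :: 'a}) = d"
    using gen range_powi[OF d(2) \<open>d > 0\<close>] card_powers[OF d(2) \<open>d > 0\<close>] by simp
  with d show ?thesis by (simp add: card_Diff_singleton)
qed

section \<open>Primitive quadratic polynomials in characteristic two\<close>

locale even_finite_field =
  fixes q m :: nat and F :: "'a::finite_field itself"
  assumes q_card: "q = CARD('a)" and m_pos: "m \<ge> 1" and q_power: "q = 2 ^ m"
begin

lemma q_even: "even q" and q_ge_2: "q \<ge> 2"
  using m_pos self_le_power[of "2::nat" m] by (auto simp: q_power)

lemma coprime_q: "coprime (q - 1) (q + 1)"
proof -
  have "q + 1 = (q - 1) + 2"
    using q_ge_2 by simp
  moreover have "coprime (q - 1) 2"
    using q_even q_ge_2 by simp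
  ultimately show ?thesis
    by (metis coprime_iff_gcd_eq_1 gcd_add2)
qed

lemma power_q: "x ^ q = x" for x :: 'a
  by (simp add: q_card finite_field_power_card_eq_same)

text \<open>Since \<open>q\<close> is even, -1 = (-1)^q = 1.\<close>

lemma CHAR_2: "CHAR('a) = 2"
proof -
  have "(-1 :: 'a) = (-1) ^ q" by (simp only: power_q)
  hence "of_nat 2 = (0 :: 'a)"
    using q_even by (simp add: neg_eq_iff_add_eq_0)
  hence "CHAR('a) dvd 2"
    by (simp only: of_nat_eq_0_iff_char_dvd)
  thus ?thesis
    using CHAR_not_1'[where 'a = 'a] two_is_prime_nat by (auto simp: prime_nat_iff)
qed

lemma of_nat_q_ac: "of_nat q = (0 :: 'a alg_closure)"
  using q_even by (simp add: of_nat_eq_0_iff_char_dvd CHAR_2)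

lemma minus_ac: "- x = (x :: 'a alg_closure)"
proof -
  have "of_nat 2 = (0 :: 'a alg_closure)"
    by (simp only: of_nat_eq_0_iff_char_dvd CHAR_alg_closure CHAR_2 dvd_refl)
  hence "x + x = 0"
    by (simp flip: mult_2)
  thus ?thesis by (simp add: neg_eq_iff_add_eq_0)
qed

lemma add_self_ac: "x + x = (0 :: 'a alg_closure)"
  by (metis minus_ac add.right_inverse)

lemma add_power_q: "(x + y) ^ q = x ^ q + y ^ q" for x y :: "'a alg_closure"
  by (rule freshmans_dream'[of _ m]) (simp_all add: CHAR_2 q_power)

lemma sum_power2: "sum f A ^ 2 = (\<Sum>x\<in>A. f x ^ 2)" for f :: "'b \<Rightarrow> 'a alg_closure"
  by (rule freshmans_dream_sum) (simp_all add: CHAR_2)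

lemma to_ac_power_q: "to_ac x ^ q = to_ac (x :: 'a)"
  by (simp add: power_q flip: to_ac_power)

text \<open>The fixed points are the roots of X^q - X, at most \<open>q\<close> many, and the image
  of the base field already supplies \<open>q\<close> of them.\<close>

lemma in_range_to_ac:
  fixes x :: "'a alg_closure"
  assumes "x ^ q = x"
  shows "x \<in> range to_ac"
proof -
  let ?p = "monom 1 q - monom 1 1 :: 'a alg_closure poly"
  have coeff: "Polynomial.coeff ?p q = 1"
    using q_ge_2 by simp
  hence nz: "?p \<noteq> 0"
    by (metis coeff_0 zero_neq_one)
  have "card {x. poly ?p x = 0} \<le> Polynomial.degree ?p"
    by (rule card_poly_roots_bound[OF nz])
  also have "\<dots> \<le> q"
    using q_ge_2 by (intro degree_diff_le order.trans[OF degree_monom_le]) auto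
  finally have "card {x. poly ?p x = 0} \<le> q" .
  moreover have "card (range (to_ac :: 'a \<Rightarrow> _)) = q"
    by (simp add: card_image inj_to_ac q_card)
  moreover have "range (to_ac :: 'a \<Rightarrow> _) \<subseteq> {x. poly ?p x = 0}"
    by (auto simp: poly_monom to_ac_power_q)
  ultimately have "range to_ac = {x. poly ?p x = 0}"
    using poly_roots_finite[OF nz] by (intro card_seteq) auto
  with assms show ?thesis by (auto simp: poly_monom)
qed

text \<open>The order of \<open>\<beta>\<close> is read off from two powers:
  \<open>\<beta> ^ (q - 1)\<close> is \<open>\<zeta>\<close>, of order q+1, and
  \<open>\<beta> ^ (q + 1)\<close> is the norm \<open>c\<close>, of order q-1. These orders are
  coprime. Degree one is impossible for the minimal polynomial because \<open>\<zeta>\<close>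
  differs from 1, so \<open>\<beta>\<close> is not fixed by the q-th power.\<close>

lemma primitive_quadratic_if_ratio_order:
  fixes \<alpha> \<beta> :: "'a alg_closure" and c :: 'a
  assumes c: "has_order (q - 1) c" and prod: "\<alpha> * \<beta> = to_ac c"
    and ord: "has_order (q + 1) (\<alpha> / \<beta>)"
  shows "\<exists>b. \<alpha> + \<beta> = to_ac b \<and> primitive_polynomial [:c, b, 1:]"
proof -
  define \<zeta> where "\<zeta> = \<alpha> / \<beta>"
  have c1: "to_ac c ^ (q - 1) = 1"
    using has_order_power[OF c] by (simp flip: to_ac_power)
  have "\<alpha> * \<beta> \<noteq> 0"
    using c1 q_ge_2 by (auto simp: prod power_0_left)
  hence nz: "\<alpha> \<noteq> 0" "\<beta> \<noteq> 0" by auto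
  have \<zeta>: "\<zeta> ^ (q + 1) = 1"
    using has_order_power[OF ord] by (simp only: \<zeta>_def)
  have \<alpha>: "\<alpha> = \<beta> * \<zeta>"
    using nz by (simp add: \<zeta>_def)
  have "q + 1 = q - 1 + 2" using q_ge_2 by simp
  with \<zeta> have \<zeta>2: "\<zeta> ^ (q - 1) * \<zeta> ^ 2 = 1"
    by (metis power_add)
  \<comment> \<open>Inserting this factor 1 turns one of the two copies of \<open>\<beta>\<close>
    into \<open>\<alpha>\<close>, so that the (q-1)-th power of the product \<open>c\<close>
    appears, which is 1.\<close>
  have "(\<beta> ^ (q - 1)) ^ 2 = (\<beta> ^ (q - 1)) ^ 2 * (\<zeta> ^ (q - 1) * \<zeta> ^ 2)"
    by (simp only: \<zeta>2 mult_1_right)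
  also have "\<dots> = (\<beta> * \<zeta> * \<beta>) ^ (q - 1) * \<zeta> ^ 2"
    by (simp only: power_mult_distrib power2_eq_square ac_simps)
  also have "\<dots> = \<zeta> ^ 2"
    using c1 prod by (simp add: \<alpha>)
  finally have "\<beta> ^ (q - 1) = \<zeta> \<or> \<beta> ^ (q - 1) = - \<zeta>"
    by (simp only: power2_eq_iff)
  hence \<beta>_q1: "\<beta> ^ (q - 1) = \<zeta>"
    by (simp only: minus_ac disj_absorb)
  have "\<beta> ^ Suc (q - 1) = \<alpha>"
    by (simp only: power_Suc \<beta>_q1 \<alpha>)
  hence \<beta>_q: "\<beta> ^ q = \<alpha>" using q_ge_2 by simp
  have "\<alpha> ^ q = \<beta> ^ q * \<zeta> ^ q"
    by (simp add: \<alpha> power_mult_distrib)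
  also have "\<dots> = \<beta> * \<zeta> ^ (q + 1)"
    by (simp add: \<beta>_q \<alpha>)
  finally have \<alpha>_q: "\<alpha> ^ q = \<beta>" using \<zeta> by simp
  have "(\<alpha> + \<beta>) ^ q = \<alpha> + \<beta>"
    by (simp add: add_power_q \<alpha>_q \<beta>_q add.commute)
  then obtain b where b: "\<alpha> + \<beta> = to_ac b"
    using in_range_to_ac by blast

  let ?n = "(q - 1) * (q + 1)"
  have n: "q ^ 2 = Suc ?n"
    using q_ge_2 by (simp add: power2_eq_square algebra_simps diff_mult_distrib)
  have n_pos: "?n > 0" using q_ge_2 by simp
  have order_\<beta>: "has_order ?n \<beta>"
    unfolding has_order_def
  proof (intro allI iffI)
    fix k assume k: "\<beta> ^ k = 1"
    have "\<zeta> ^ k = (\<beta> ^ k) ^ (q - 1)"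
      by (simp only: \<beta>_q1[symmetric] power_mult[symmetric] mult.commute)
    with k ord have 1: "q + 1 dvd k"
      by (simp add: has_order_def \<zeta>_def)
    have "\<beta> ^ (q + 1) = to_ac c"
      using \<beta>_q prod by (simp add: mult.commute)
    hence "to_ac c ^ k = (\<beta> ^ k) ^ (q + 1)"
      by (metis power_mult mult.commute)
    with k have "c ^ k = 1"
      by (metis power_one to_ac_1 to_ac_eq_iff to_ac_power)
    with c have "q - 1 dvd k"
      by (simp only: has_order_def)
    with 1 coprime_q show "?n dvd k"
      by (intro divides_mult)
  next
    fix k assume "?n dvd k"
    then obtain l where "k = ?n * l" by blast
    thus "\<beta> ^ k = 1"
      by (simp only: power_mult \<beta>_q1 \<zeta> power_one)
  qed
  have gen: "generates_nonzero (field_ext 2) \<beta>"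
  proof -
    let ?p = "monom 1 ?n - 1 :: 'a alg_closure poly"
    have nz_p: "?p \<noteq> 0"
      using degree_xn_1[OF n_pos, where 'a = "'a alg_closure"] n_pos by (metis degree_0 less_irrefl)
    have eq: "field_ext 2 - {0} = {x :: 'a alg_closure. poly ?p x = 0}"
    proof -
      have "x ^ (q ^ 2) = x \<and> x \<noteq> 0 \<longleftrightarrow> x ^ ?n = 1" for x :: "'a alg_closure"
        using q_ge_2 unfolding n power_Suc by (cases "x = 0") (simp_all add: power_0_left)
      thus ?thesis
        by (auto simp: field_ext_def poly_monom simp flip: q_card)
    qed
    \<comment> \<open>The powers of \<open>\<beta>\<close> are \<open>?n\<close> distinct roots of a
      polynomial of degree \<open>?n\<close>, hence all of them.\<close>
    have "(\<lambda>i. \<beta> ^ i) ` {..<?n} = {x :: 'a alg_closure. poly ?p x = 0}"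
    proof (rule card_seteq)
      show "finite {x :: 'a alg_closure. poly ?p x = 0}"
        by (rule poly_roots_finite[OF nz_p])
      have "(\<beta> ^ i) ^ ?n = 1" for i
        by (metis power_mult mult.commute has_order_power[OF order_\<beta>] power_one)
      thus "(\<lambda>i. \<beta> ^ i) ` {..<?n} \<subseteq> {x. poly ?p x = 0}"
        by (auto simp only: poly_diff poly_monom poly_1 mult_1_left diff_self mem_Collect_eq image_subset_iff)
      show "card {x :: 'a alg_closure. poly ?p x = 0} \<le> card ((\<lambda>i. \<beta> ^ i) ` {..<?n})"
        using card_poly_roots_bound[OF nz_p]
        by (simp only: card_powers[OF order_\<beta> n_pos] degree_xn_1[OF n_pos])
    qed
    thus ?thesis
      by (simp only: generates_nonzero_def eq range_powi[OF order_\<beta> n_pos])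
  qed
  have "is_minimal_poly [:c, b, 1:] \<beta>"
    unfolding is_minimal_poly_def
  proof (intro conjI allI impI)
    show "Polynomial.lead_coeff [:c, b, 1:] = 1" by simp
    have "poly (map_poly to_ac [:c, b, 1:]) \<beta> = \<alpha> * \<beta> + \<beta> * (\<alpha> + \<beta> + \<beta>)"
      by (simp add: map_poly_pCons prod b)
    also have "\<dots> = \<alpha> * \<beta> + \<alpha> * \<beta>"
      by (simp only: add.assoc add_self_ac add_0_right mult.commute)
    finally show "poly (map_poly to_ac [:c, b, 1:]) \<beta> = 0"
      by (simp only: add_self_ac)
  next
    fix g :: "'a poly" assume g: "g \<noteq> 0" "poly (map_poly to_ac g) \<beta> = 0"
    show "Polynomial.degree [:c, b, 1:] \<le> Polynomial.degree g"
    proof (rule ccontr)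
      assume "\<not> Polynomial.degree [:c, b, 1:] \<le> Polynomial.degree g"
      hence "Polynomial.degree g \<le> 1" by simp
      moreover obtain u h where h: "g = pCons u h"
        by (cases g)
      ultimately have "Polynomial.degree h = 0"
        by (auto split: if_splits)
      with h obtain v where uv: "g = [:u, v:]"
        by (metis degree_eq_zeroE)
      have zero: "to_ac u + to_ac v * \<beta> = 0"
        using g(2) by (simp add: uv map_poly_pCons mult.commute)
      have "v \<noteq> 0" using zero g(1) by (auto simp: uv)
      hence "\<beta> = to_ac (- u / v)"
        using zero by (simp add: field_simps eq_neg_iff_add_eq_0 add.commute)
      hence "\<beta> ^ q = \<beta>"
        by (metis to_ac_power_q)
      hence "\<zeta> = 1"
        using \<beta>_q nz by (simp add: \<zeta>_def)
      hence "\<zeta> ^ 1 = 1" by simp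
      hence "q + 1 dvd 1"
        using ord unfolding has_order_def \<zeta>_def by blast
      with q_ge_2 show False by simp
    qed
  qed
  with gen have "primitive_polynomial [:c, b, 1:]"
    unfolding primitive_polynomial_def by (auto simp: numeral_2_eq_2)
  with b show ?thesis by blast
qed

lemma has_order_inverse: "has_order n (inverse x) \<longleftrightarrow> has_order n x" for x :: "'b::field"
  by (simp add: has_order_def power_inverse inverse_eq_1_iff)

lemma ratio_order_if_primitive_quadratic:
  fixes \<alpha> \<beta> :: "'a alg_closure" and b c :: 'a
  assumes prim: "primitive_polynomial [:c, b, 1:]"
    and prod: "\<alpha> * \<beta> = to_ac c" and sum: "\<alpha> + \<beta> = to_ac b" and "c \<noteq> 0"
  shows "has_order (q + 1) (\<alpha> / \<beta>)"
proof -
  obtain g where gen: "generates_nonzero (field_ext 2) g" and minpoly: "is_minimal_poly [:c, b, 1:] g"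
    using prim by (auto simp: primitive_polynomial_def numeral_2_eq_2)
  have roots: "x = \<alpha> \<or> x = \<beta>" if "to_ac c + x * (to_ac b + x) = 0" for x
  proof -
    have "(x + \<alpha>) * (x + \<beta>) = to_ac c + x * (to_ac b + x)"
      by (simp add: algebra_simps flip: prod sum)
    with that have "x = - \<alpha> \<or> x = - \<beta>"
      by (auto simp: eq_neg_iff_add_eq_0)
    thus ?thesis by (simp only: minus_ac)
  qed
  have g_root: "to_ac c + g * (to_ac b + g) = 0"
    using minpoly by (simp add: is_minimal_poly_def map_poly_pCons)
  \<comment> \<open>The q-th power map fixes \<open>b\<close> and \<open>c\<close>, so it permutes
    the roots.\<close>
  have "to_ac c + g ^ q * (to_ac b + g ^ q) = (to_ac c + g * (to_ac b + g)) ^ q"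
    by (simp only: add_power_q power_mult_distrib to_ac_power_q)
  also have "\<dots> = 0"
    using g_root q_ge_2 by (simp add: power_0_left)
  finally have gq_root: "to_ac c + g ^ q * (to_ac b + g ^ q) = 0" .

  let ?n = "(q - 1) * (q + 1)"
  have n: "q ^ 2 = Suc ?n"
    using q_ge_2 by (simp add: power2_eq_square algebra_simps diff_mult_distrib)
  have range: "range (\<lambda>i::int. g powi i) = {x. x ^ (q ^ 2) = x} - {0}"
    using gen by (simp only: generates_nonzero_def field_ext_def q_card)
  have "g powi 1 \<in> {x. x ^ (q ^ 2) = x} - {0}"
    unfolding range[symmetric] by (rule rangeI)
  hence g: "g \<noteq> 0" "g ^ ?n = 1"
    unfolding n by auto
  \<comment> \<open>The order of \<open>g\<close> is not computed. An element of order q+1 in the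
    closure lies in the field with q^2 elements, so it is a power of \<open>g\<close>; hence every
    exponent killing \<open>g\<close> is divisible by q+1.\<close>
  obtain \<zeta> :: "'a alg_closure" where \<zeta>: "has_order (q + 1) \<zeta>"
    using ex_has_order_alg_closed[of "q + 1", where 'a = "'a alg_closure"] of_nat_q_ac by auto
  have "\<zeta> ^ ?n = 1"
    using has_order_power[OF \<zeta>] by (metis power_mult mult.commute power_one)
  moreover have "\<zeta> \<noteq> 0"
    using has_order_power[OF \<zeta>] by auto
  ultimately have "\<zeta> \<in> range (\<lambda>i::int. g powi i)"
    unfolding range n by simp
  then obtain i :: int where i: "\<zeta> = g powi i" by blast
  have dvd: "q + 1 dvd k" if "g ^ k = 1" for k
  proof -
    have "\<zeta> ^ k = (g ^ k) powi i"
      unfolding i by (metis mult.commute power_int_mult power_int_of_nat)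
    with that have "\<zeta> ^ k = 1" by simp
    with \<zeta> show ?thesis by (simp only: has_order_def)
  qed
  have ord: "has_order (q + 1) (g ^ (q - 1))"
    unfolding has_order_def
  proof (intro allI iffI)
    fix k assume "(g ^ (q - 1)) ^ k = 1"
    hence "q + 1 dvd (q - 1) * k"
      by (intro dvd) (simp add: power_mult)
    thus "q + 1 dvd k"
      using coprime_q by (simp add: coprime_dvd_mult_right_iff coprime_commute)
  next
    fix k assume "q + 1 dvd k"
    then obtain l where "k = (q + 1) * l" by blast
    hence "(g ^ (q - 1)) ^ k = (g ^ ?n) ^ l"
      by (simp only: power_mult)
    with g show "(g ^ (q - 1)) ^ k = 1" by simp
  qed
  have "g ^ Suc (q - 1) = g * g ^ (q - 1)" by simp
  hence gq: "g ^ q = g * g ^ (q - 1)" using q_ge_2 by simp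
  have "g ^ q \<noteq> g"
  proof
    assume "g ^ q = g"
    hence "g ^ (q - 1) = 1" using gq g by simp
    hence "q + 1 dvd q - 1" by (rule dvd)
    with q_ge_2 show False by (auto dest: dvd_imp_le)
  qed
  \<comment> \<open>The two conjugates are distinct, so they are \<open>\<alpha>\<close> and
    \<open>\<beta>\<close> in some order; swapping them only inverts the ratio.\<close>
  with roots[OF g_root] roots[OF gq_root]
  consider "\<alpha> = g" "\<beta> = g * g ^ (q - 1)" | "\<alpha> = g * g ^ (q - 1)" "\<beta> = g"
    unfolding gq by auto
  thus ?thesis
  proof cases
    case 1
    hence "\<alpha> / \<beta> = inverse (g ^ (q - 1))"
      using g by (simp add: field_simps)
    with ord show ?thesis by (simp only: has_order_inverse)
  next
    case 2
    with ord g show ?thesis by simp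
  qed
qed

end

section \<open>Polynomials with simple roots\<close>

lemma prod_roots_dvd:
  fixes p :: "'a::field poly"
  assumes "finite S" "\<And>x. x \<in> S \<Longrightarrow> poly p x = 0"
  shows "(\<Prod>x\<in>S. [:-x, 1:]) dvd p"
  using assms
proof (induction S rule: finite_induct)
  case (insert y S)
  then obtain e where e: "p = (\<Prod>x\<in>S. [:-x, 1:]) * e"
    by (metis dvdE insert_iff)
  have "poly p y = 0" using insert.prems by simp
  hence "poly e y = 0"
    using insert.hyps unfolding e by (auto simp: poly_prod prod_zero_iff)
  hence "[:-y, 1:] dvd e" by (simp add: poly_eq_0_iff_dvd)
  hence "(\<Prod>x\<in>S. [:-x, 1:]) * [:-y, 1:] dvd p"
    unfolding e by (intro mult_dvd_mono dvd_refl)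
  thus ?case using insert.hyps by (simp add: mult.commute)
qed simp

lemma
  fixes p :: "'a::field poly"
  assumes lead: "Polynomial.lead_coeff p = 1" and fin: "finite S"
    and roots: "{x. poly (map_poly to_ac p) x = 0} = to_ac ` S"
    and simple: "\<And>x. poly (map_poly to_ac p) x = 0 \<Longrightarrow> poly (pderiv (map_poly to_ac p)) x \<noteq> 0"
  shows squarefree_if_simple_roots: "squarefree p"
    and eq_prod_if_simple_roots: "p = (\<Prod>x\<in>S. [:-x, 1:])"
proof -
  have no_common: False
    if "p = f * g" "poly (map_poly to_ac f) x = 0" "poly (map_poly to_ac g) x = 0" for f g x
  proof -
    have "map_poly to_ac p = map_poly to_ac f * map_poly to_ac g"
      by (simp only: that(1) to_ac_hom.map_poly_mult)
    with that(2,3) simple[of x] show False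
      by (simp add: pderiv_mult)
  qed
  have ex_root: "\<exists>x. poly (map_poly to_ac f) x = 0" if "Polynomial.degree f > 0" for f :: "'a poly"
    by (rule alg_closed_imp_poly_has_root) (use that in \<open>simp add: degree_map_poly\<close>)
  have nz: "p \<noteq> 0" using lead by auto
  show "squarefree p"
  proof (rule squarefreeI)
    fix f assume "f ^ 2 dvd p"
    then obtain h where h: "p = f * (f * h)"
      by (metis dvdE mult.assoc power2_eq_square)
    have "Polynomial.degree f = 0"
    proof (rule ccontr)
      assume "Polynomial.degree f \<noteq> 0"
      then obtain x where x: "poly (map_poly to_ac f) x = 0"
        using ex_root by blast
      hence "poly (map_poly to_ac (f * h)) x = 0"
        by (simp add: to_ac_hom.map_poly_mult)
      with x h no_common show False by blast
    qed
    moreover have "f \<noteq> 0" using h nz by auto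
    ultimately show "f dvd 1" by (simp add: is_unit_iff_degree)
  qed
  have root_S: "poly p x = 0" if "x \<in> S" for x
  proof -
    have "to_ac x \<in> {x. poly (map_poly to_ac p) x = 0}"
      unfolding roots using that by blast
    thus ?thesis by (simp add: to_ac_hom.poly_map_poly)
  qed
  then obtain e where e: "p = (\<Prod>x\<in>S. [:-x, 1:]) * e"
    using prod_roots_dvd[OF fin] by blast
  have "Polynomial.lead_coeff e = 1"
    using lead by (simp add: e lead_coeff_mult lead_coeff_prod)
  moreover have "Polynomial.degree e = 0"
  proof (rule ccontr)
    assume "Polynomial.degree e \<noteq> 0"
    then obtain x where x: "poly (map_poly to_ac e) x = 0"
      using ex_root by blast
    hence "x \<in> {x. poly (map_poly to_ac p) x = 0}"
      by (simp add: e to_ac_hom.map_poly_mult)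
    then obtain b where b: "x = to_ac b" "b \<in> S"
      unfolding roots by blast
    have "poly (\<Prod>x\<in>S. [:-x, 1:]) b = 0"
      using b fin by (auto simp: poly_prod intro!: prod_zero)
    hence "poly (map_poly to_ac (\<Prod>x\<in>S. [:-x, 1:])) x = 0"
      unfolding b by (simp only: to_ac_hom.poly_map_poly to_ac_0)
    with x e no_common show False by blast
  qed
  ultimately have "e = 1"
    by (metis degree_eq_zeroE lead_coeff_pCons(2) pCons_one lead_coeff_pCons(1))
  with e show "p = (\<Prod>x\<in>S. [:-x, 1:])" by simp
qed

lemma pderiv_sum: "pderiv (\<Sum>x\<in>A. f x) = (\<Sum>x\<in>A. pderiv (f x))"
  by (induction A rule: infinite_finite_induct) (simp_all add: pderiv_add)

text \<open>Multiplying by \<open>x\<close> restores the exponent \<open>n\<close>, so each monomial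
  is merely weighted by its degree, also when \<open>n\<close> is 0.\<close>

lemma poly_pderiv_monom:
  "x * poly (pderiv (monom c n)) x = of_nat n * c * x ^ n" for x :: "'a::idom"
  by (cases n) (simp_all add: pderiv_monom poly_monom algebra_simps)

lemma poly_pderiv_altdef:
  fixes x :: "'a::idom"
  shows "x * poly (pderiv p) x = (\<Sum>i\<le>Polynomial.degree p. of_nat i * Polynomial.coeff p i * x ^ i)"
proof -
  have "x * poly (pderiv (\<Sum>i\<le>Polynomial.degree p. monom (Polynomial.coeff p i) i)) x =
      (\<Sum>i\<le>Polynomial.degree p. of_nat i * Polynomial.coeff p i * x ^ i)"
    by (simp only: pderiv_sum poly_sum sum_distrib_left poly_pderiv_monom)
  thus ?thesis by (simp only: poly_as_sum_of_monoms)
qed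

section \<open>Roots of the determining polynomial\<close>

context even_finite_field
begin

lemma cyclotomic_root_primitive_element:
  assumes "primitive_element (c::'a)"
  shows "poly (cyclotomic (CARD('a) - 1)) c = 0"
proof -
  have "of_nat (q - 1) \<noteq> (0 :: 'a)"
  proof
    assume "of_nat (q - 1) = (0 :: 'a)"
    moreover have "of_nat (Suc (q - 1)) = (0 :: 'a)"
      using q_ge_2 q_even by (simp add: of_nat_eq_0_iff_char_dvd CHAR_2)
    ultimately show False by simp
  qed
  thus ?thesis
    using primitive_element_has_order[OF assms] q_ge_2
    by (subst cyclotomic_root_iff) (simp_all add: q_card)
qed

text \<open>The exponent used by \<open>inv_Frobenius\<close> extracts square roots in the base
  field.\<close>

lemma power_q_div_2: "(x ^ (q div 2)) ^ 2 = x" for x :: 'a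
proof -
  have "(x ^ (q div 2)) ^ 2 = x ^ q"
    using q_even by (simp flip: power_mult)
  thus ?thesis by (simp only: power_q)
qed

text \<open>Natural numbers land in the prime field, where 0 and 1 are their own squares.\<close>

lemma of_nat_power2_ac: "of_nat i ^ 2 = (of_nat i :: 'a alg_closure)"
proof (cases "even i")
  case True
  hence "of_nat i = (0 :: 'a alg_closure)"
    by (simp add: of_nat_eq_0_iff_char_dvd CHAR_2)
  thus ?thesis by simp
next
  case False
  then obtain j where "i = Suc (2 * j)" by (elim oddE) simp
  moreover have "of_nat (2 * j) = (0 :: 'a alg_closure)"
    by (simp only: of_nat_eq_0_iff_char_dvd CHAR_2 CHAR_alg_closure) simp
  ultimately show ?thesis by (simp only: of_nat_Suc) simp
qed

section \<open>The polynomial R = P(B,c), given through its coefficients\<close>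

context
  fixes a :: "nat \<Rightarrow> int" and k :: nat and c :: 'a and R :: "'a poly"
  assumes k: "totient (q + 1) = 2 * k" and a_0: "a 0 = 1"
    and a: "cyclotomic_int (q + 1) = (\<Sum>j\<le>k. monom (a j) j * [:1, 1:] ^ (2 * (k - j)))"
    and coeff_R: "\<And>i. i \<le> k \<Longrightarrow> Polynomial.coeff R i = (of_int (a (k - i)) * c ^ (k - i)) ^ (q div 2)"
    and coeff_R_0: "\<And>i. i > k \<Longrightarrow> Polynomial.coeff R i = 0"
    and c: "has_order (q - 1) c"
begin

lemma coeff_R_k: "Polynomial.coeff R k = 1"
  by (simp add: coeff_R a_0)

lemma degree_R: "Polynomial.degree R = k"
  using coeff_R_0 coeff_R_k by (intro antisym degree_le le_degree) auto

abbreviation R_ac :: "'a alg_closure poly" where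
  "R_ac \<equiv> map_poly to_ac R"

lemma degree_R_ac: "Polynomial.degree R_ac = k"
  by (simp add: degree_map_poly degree_R)

lemma coeff_R_ac_power2:
  "i \<le> k \<Longrightarrow> Polynomial.coeff R_ac i ^ 2 = of_int (a (k - i)) * to_ac c ^ (k - i)"
  by (simp add: coeff_map_poly coeff_R power_q_div_2 flip: to_ac_power)

lemma c_nz: "c \<noteq> 0"
  using has_order_power[OF c] q_ge_2 by (auto simp: power_0_left)

lemma sum_reverse: "(\<Sum>i\<le>k. f (k - i) i) = (\<Sum>j\<le>k. f j (k - j))"
  by (rule sum.reindex_bij_witness[of _ "\<lambda>j. k - j" "\<lambda>j. k - j"]) auto

text \<open>The right-hand side is the Lucas atom at B = \<open>x\<close>, C = \<open>c\<close>; the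
  square acts on each term separately and removes the square roots from the coefficients.\<close>

lemma poly_R_ac_power2:
  "poly R_ac x ^ 2 = (\<Sum>j\<le>k. of_int (a j) * to_ac c ^ j * x ^ (2 * (k - j)))"
proof -
  have "poly R_ac x ^ 2 = (\<Sum>i\<le>k. (Polynomial.coeff R_ac i * x ^ i) ^ 2)"
    by (simp only: poly_altdef degree_R_ac sum_power2)
  also have "\<dots> = (\<Sum>i\<le>k. of_int (a (k - i)) * to_ac c ^ (k - i) * x ^ (2 * i))"
    by (intro sum.cong) (simp_all add: power_mult_distrib coeff_R_ac_power2 power_mult power_commutes
        flip: power_mult mult.commute[of 2])
  also have "\<dots> = (\<Sum>j\<le>k. of_int (a j) * to_ac c ^ j * x ^ (2 * (k - j)))"
    by (rule sum_reverse)
  finally show ?thesis .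
qed

text \<open>Squaring leaves the weights unchanged by \<open>of_nat_power2_ac\<close>, so the
  summands of \<open>poly_R_ac_power2\<close> reappear, each with its weight.\<close>

lemma poly_pderiv_R_ac_power2:
  "(x * poly (pderiv R_ac) x) ^ 2 =
    (\<Sum>j\<le>k. of_nat (k - j) * (of_int (a j) * to_ac c ^ j * x ^ (2 * (k - j))))"
proof -
  have "(x * poly (pderiv R_ac) x) ^ 2 = (\<Sum>i\<le>k. (of_nat i * Polynomial.coeff R_ac i * x ^ i) ^ 2)"
    by (simp only: poly_pderiv_altdef degree_R_ac sum_power2)
  also have "\<dots> = (\<Sum>i\<le>k. of_nat i * (of_int (a (k - i)) * to_ac c ^ (k - i) * x ^ (2 * i)))"
    by (intro sum.cong) (simp_all add: power_mult_distrib of_nat_power2_ac coeff_R_ac_power2 mult.assoc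
        flip: power_mult mult.commute[of 2])
  also have "\<dots> = (\<Sum>j\<le>k. of_nat (k - j) * (of_int (a j) * to_ac c ^ j * x ^ (2 * (k - j))))"
    by (rule sum_reverse)
  finally show ?thesis .
qed

lemma root_R_ac_iff:
  assumes "\<alpha> * \<beta> = to_ac c"
  shows "poly R_ac (\<alpha> + \<beta>) = 0 \<longleftrightarrow> has_order (q + 1) (\<alpha> / \<beta>)"
proof -
  have nz: "\<beta> \<noteq> 0" using assms c_nz by auto
  have "poly R_ac (\<alpha> + \<beta>) ^ 2 = cyclotomic_hom (q + 1) \<alpha> \<beta>"
    unfolding poly_R_ac_power2 cyclotomic_hom_eq[OF nz k cyclotomic_decomposition[OF a]] assms ..
  hence "poly R_ac (\<alpha> + \<beta>) = 0 \<longleftrightarrow> cyclotomic_hom (q + 1) \<alpha> \<beta> = 0"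
    by (metis zero_eq_power2)
  also have "\<dots> \<longleftrightarrow> poly (cyclotomic (q + 1)) (\<alpha> / \<beta>) = 0"
    using nz by (simp add: cyclotomic_hom_def)
  also have "\<dots> \<longleftrightarrow> has_order (q + 1) (\<alpha> / \<beta>)"
    by (rule cyclotomic_root_iff) (simp_all add: of_nat_q_ac)
  finally show ?thesis .
qed

text \<open>Here \<open>x\<close> ranges over the whole closure, so roots of \<open>R\<close>
  outside the base field are covered and can be excluded.\<close>

lemma ex_sum_prod: "\<exists>\<alpha> \<beta>. \<alpha> * \<beta> = to_ac c \<and> \<alpha> + \<beta> = (x :: 'a alg_closure)"
proof -
  obtain \<alpha> \<beta> where "[:to_ac c, x, 1:] = [:-\<alpha>, 1:] * [:-\<beta>, 1:]"
    using quadratic_splits by blast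
  hence "\<alpha> * \<beta> = to_ac c \<and> \<alpha> + \<beta> = x"
    by (simp add: minus_ac add.commute)
  thus ?thesis by blast
qed

lemma roots_R_ac: "{x. poly R_ac x = 0} = to_ac ` {b. primitive_polynomial [:c, b, 1:]}"
proof (intro equalityI subsetI)
  fix x assume "x \<in> {x. poly R_ac x = 0}"
  moreover obtain \<alpha> \<beta> where "\<alpha> * \<beta> = to_ac c" "\<alpha> + \<beta> = x"
    using ex_sum_prod by blast
  ultimately show "x \<in> to_ac ` {b. primitive_polynomial [:c, b, 1:]}"
    using primitive_quadratic_if_ratio_order[OF c] root_R_ac_iff by blast
next
  fix x assume "x \<in> to_ac ` {b. primitive_polynomial [:c, b, 1:]}"
  then obtain b where b: "x = to_ac b" "primitive_polynomial [:c, b, 1:]" by blast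
  obtain \<alpha> \<beta> where *: "\<alpha> * \<beta> = to_ac c" "\<alpha> + \<beta> = to_ac b"
    using ex_sum_prod by blast
  hence "poly R_ac (\<alpha> + \<beta>) = 0"
    using ratio_order_if_primitive_quadratic[OF b(2) _ _ c_nz] root_R_ac_iff by blast
  with * b(1) show "x \<in> {x. poly R_ac x = 0}"
    by simp
qed

text \<open>In characteristic two the derivative of \<open>(X + 1)\<^sup>2\<close> vanishes, so that \<open>X \<Phi>'(X)\<close> has the
  summands of \<open>\<Phi>(X)\<close> weighted by \<open>j\<close>; a double root of \<open>R\<close> makes the homogenisation of this sum vanish.\<close>

lemma simple_roots_R_ac:
  assumes root: "poly R_ac x = 0"
  shows "poly (pderiv R_ac) x \<noteq> 0"
proof
  assume double: "poly (pderiv R_ac) x = 0"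
  obtain \<alpha> \<beta> where prod: "\<alpha> * \<beta> = to_ac c" and sum: "\<alpha> + \<beta> = x"
    using ex_sum_prod by blast
  have nz: "\<alpha> \<noteq> 0" "\<beta> \<noteq> 0" using prod c_nz by auto
  define \<zeta> where "\<zeta> = \<alpha> / \<beta>"
  define t where "t j = of_int (a j) * to_ac c ^ j * x ^ (2 * (k - j))" for j
  have t_sum: "(\<Sum>j\<le>k. t j) = 0"
    using poly_R_ac_power2[of x] root by (simp add: t_def)
  have "(\<Sum>j\<le>k. of_nat (k - j) * t j) = 0"
    using poly_pderiv_R_ac_power2[of x] double by (simp add: t_def)
  hence "(\<Sum>j\<le>k. of_nat k * t j - of_nat j * t j) = 0"
    by (simp add: of_nat_diff left_diff_distrib)
  \<comment> \<open>The weights k-j become j because the unweighted sum vanishes at the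
    root.\<close>
  hence t_weighted: "(\<Sum>j\<le>k. of_nat j * t j) = 0"
    using t_sum by (simp add: sum_subtractf flip: sum_distrib_left)
  let ?u = "[:1, 1:] :: 'a alg_closure poly"
  have deriv_u: "pderiv (?u ^ (2 * i)) = 0" for i
  proof -
    have "of_nat (2 * i) = (0 :: 'a alg_closure)"
      by (simp only: of_nat_eq_0_iff_char_dvd CHAR_2 CHAR_alg_closure) simp
    thus ?thesis by (simp only: pderiv_power smult_0_left)
  qed
  have poly_u: "poly ?u \<zeta> = 1 + \<zeta>" by simp
  have "\<zeta> * poly (pderiv (cyclotomic (q + 1))) \<zeta> =
      (\<Sum>j\<le>k. \<zeta> * poly (pderiv (monom (of_int (a j)) j)) \<zeta> * (1 + \<zeta>) ^ (2 * (k - j)))"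
    unfolding cyclotomic_decomposition[OF a] pderiv_sum pderiv_mult deriv_u mult_zero_right add_0_left
      poly_sum poly_mult poly_power poly_u sum_distrib_left
    by (simp only: ac_simps)
  also have "\<dots> = (\<Sum>j\<le>k. of_nat j * of_int (a j) * \<zeta> ^ j * (1 + \<zeta>) ^ (2 * (k - j)))"
    by (simp only: poly_pderiv_monom)
  \<comment> \<open>Homogenising as for the Lucas atom, with the weight \<open>j\<close> absorbed
    into the coefficient.\<close>
  also have "\<beta> ^ (2 * k) * \<dots> = (\<Sum>j\<le>k. of_nat j * of_int (a j) * (\<alpha> * \<beta>) ^ j * (\<alpha> + \<beta>) ^ (2 * (k - j)))"
    unfolding sum_distrib_left \<zeta>_def
    by (intro sum.cong refl homogenize_summand nz) simp
  also have "\<dots> = 0"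
    using t_weighted by (simp add: t_def prod sum mult.assoc)
  finally have "poly (pderiv (cyclotomic (q + 1))) \<zeta> = 0"
    using nz by (simp add: \<zeta>_def)
  moreover have "poly (cyclotomic (q + 1)) \<zeta> = 0"
    using root root_R_ac_iff[OF prod] of_nat_q_ac
    by (subst cyclotomic_root_iff) (simp_all add: sum \<zeta>_def)
  ultimately show False
    using pderiv_cyclotomic_nz[of "q + 1" \<zeta>] of_nat_q_ac by simp
qed

end

lemma eval_C_determines:
  fixes P :: "'a poly poly" and c :: 'a
  assumes proj: "proj_A P = inv_Frobenius (proj_A (lucas_atom (q + 1)))" and prim: "primitive_element c"
  shows "determines_primitive_quadratics P c \<and>
    eval_C P c = (\<Prod>b | primitive_polynomial [:c, b, 1:]. [:-b, 1:])"
proof -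
  obtain a k where ak: "totient (q + 1) = 2 * k" "a 0 = 1"
      "cyclotomic_int (q + 1) = (\<Sum>j\<le>k. monom (a j) j * [:1, 1:] ^ (2 * (k - j)))"
  proof (rule cyclotomic_int_decomposition)
    show "q + 1 > 2" using q_ge_2 by simp
  qed
  note lucas = lucas_atom_eq[OF ak(1) cyclotomic_decomposition[OF ak(3)], where 'a = 'a]
  note coeff_L = coeff_lucas_atom[OF lucas]
  have coeff: "Polynomial.coeff (eval_C P c) i =
      poly (Polynomial.coeff (lucas_atom (q + 1)) (2 * i)) c ^ (q div 2)" for i
    unfolding eval_C_def q_card
    using inv_Frobenius_eval[OF proj coeff_L(3) cyclotomic_root_primitive_element[OF prim], of i]
    by (simp add: coeff_map_poly q_card)
  have c: "has_order (q - 1) c"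
    using primitive_element_has_order[OF prim] by (simp add: q_card)
  have coeff_R: "Polynomial.coeff (eval_C P c) i = (of_int (a (k - i)) * c ^ (k - i)) ^ (q div 2)" if "i \<le> k" for i
    by (simp only: coeff coeff_L(1)[OF that] poly_monom)
  \<comment> \<open>Zero stays zero under the exponent only because \<open>q div 2\<close> is
    positive.\<close>
  have coeff_R_0: "Polynomial.coeff (eval_C P c) i = 0" if "i > k" for i
    unfolding coeff coeff_L(2)[OF that] using q_ge_2 by (simp add: power_0_left)
  note R = ak coeff_R coeff_R_0 c
  have lead: "Polynomial.lead_coeff (eval_C P c) = 1"
    by (simp only: degree_R[OF R] coeff_R_k[OF R])
  show ?thesis
    unfolding determines_primitive_quadratics_def
    using lead squarefree_if_simple_roots[OF lead _ roots_R_ac[OF R] simple_roots_R_ac[OF R]]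
      eq_prod_if_simple_roots[OF lead _ roots_R_ac[OF R] simple_roots_R_ac[OF R]] roots_R_ac[OF R]
    by simp
qed

end

theorem theorem5p12:
  fixes P :: "'a::finite_field poly poly" and q N m :: nat
  assumes "q = CARD('a)" and "m \<ge> 1" and "q = 2 ^ m" and "N = q + 1"
    and "proj_A P = inv_Frobenius (proj_A (lucas_atom N))"
  shows "(\<forall>c::'a. primitive_element c \<longrightarrow>
            Polynomial.lead_coeff (eval_C P c) = 1 \<and>
            squarefree (eval_C P c) \<and>
            {x. poly (map_poly to_ac (eval_C P c)) x = 0} =
              to_ac ` {b. primitive_polynomial [:c, b, 1:]}) \<and>
         optimal_determining_polynomial P"
proof -
  interpret even_finite_field q m "TYPE('a)"
    using assms by unfold_locales auto
  have "determines_primitive_quadratics P c \<and>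
      eval_C P c = (\<Prod>b | primitive_polynomial [:c, b, 1:]. [:-b, 1:])"
    if "primitive_element c" for c
    using eval_C_determines[OF _ that] assms(4,5) by simp
  thus ?thesis
    unfolding optimal_determining_polynomial_def determines_primitive_quadratics_def by blast
qed

end
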